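(* If $\Gamma$ over $D$ is a finite weakly separable cc0-language, then $\mathrm{CCSP}(\Gamma)$ and $\mathrm{OCSP}(\Gamma)$ are fixed-parameter tractable.
   Context: $D$ is a finite set with distinguished element $0$; a constraint language is a finite set of relations on $D$. A $\mathrm{CSP}(\Gamma)$ instance is $(V,\mathcal C)$ with constraints $\langle (s_1,..,s_n),R\rangle$, $R\in\Gamma$; $\tau:V\to D$ is satisfying if it satisfies all constraints; its size is the number of variables with nonzero value. $\mathrm{OCSP}(\Gamma)$: given an instance and $k$, decide whether there is a satisfying assignment of size exactly $k$. $\mathrm{CCSP}(\Gamma)$: given an instance, $\pi:D\setminus\{0\}\to\mathbb N$ and $k=\sum\pi(a)$, decide whether there is a satisfying assignment giving value $a$ to exactly $\pi(a)$ variables for each nonzero $a$. Parameter $k$; FPT means time $f(k)n^{O(1)}$. A relation is 0-valid if it contains the all-zero tuple; $\Gamma$ is a cc0-language if all its relations are 0-valid and every 0-valid relation obtained from a relation of $\Gamma$ by substituting constants for some coordinates (fixing those coordinates and deleting them) is in $\Gamma$. Tuples are disjoint if at each coordinate at least one entry is $0$; the union $\mathbf t_1+\mathbf t_2$ takes the nonzero entry at each coordinate. A 0-valid relation $R$ is weakly separable if for all disjoint tuples $\mathbf t_1,\mathbf t_2$: $\mathbf t_1,\mathbf t_2\in R\Rightarrow\mathbf t_1+\mathbf t_2\in R$, and $\mathbf t_2,\mathbf t_1+\mathbf t_2\in R\Rightarrow \mathbf t_1\in R$; $\Gamma$ is weakly separable if all its relations are. *)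

theory Defs
  imports "HOL-Library.FuncSet"
begin

section \<open>Model of computation\<close>

text \<open>
  Programs are systems of first-order recursive functions on binary trees (pure first-order LISP,
  cf. N. D. Jones, Computability and Complexity from a Programming Perspective, 1997), evaluated
  call by value. Every evaluated subexpression costs one time unit. Since trees can be shared and a
  step inspects or allocates at most one cell, this time measure is polynomially related to that of
  multi-tape Turing machines. There is deliberately no arithmetic and no unit-cost test for
  structural equality: the only test is whether a tree is \<open>Leaf\<close>.
\<close>

datatype tree = Leaf | Node tree tree

fun left :: "tree \<Rightarrow> tree" where
  "left Leaf = Leaf"
| "left (Node l r) = l"

fun right :: "tree \<Rightarrow> tree" where
  "right Leaf = Leaf"
| "right (Node l r) = r"

text \<open>
  Variables are de Bruijn indices into the environment: \<open>LetIn\<close> pushes the value of its first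
  argument, and the body of a called function sees exactly its arguments.
\<close>

datatype expr =
    Var nat
  | Quote tree
  | MkNode expr expr
  | LeftOf expr
  | RightOf expr
  | IfNode expr expr expr
  | LetIn expr expr
  | Call nat "expr list"

type_synonym prog = "expr list"

text \<open>
  \<open>eval P env e v t\<close>: in program \<open>P\<close> and environment \<open>env\<close>, the expression \<open>e\<close> evaluates to \<open>v\<close>
  in exactly \<open>t\<close> steps. Function \<open>i\<close> of the program has body \<open>P ! i\<close>. A nonterminating evaluation
  has no derivation.
\<close>

inductive
  eval :: "prog \<Rightarrow> tree list \<Rightarrow> expr \<Rightarrow> tree \<Rightarrow> nat \<Rightarrow> bool" and
  evals :: "prog \<Rightarrow> tree list \<Rightarrow> expr list \<Rightarrow> tree list \<Rightarrow> nat \<Rightarrow> bool"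
  for P :: prog
where
  eval_Var: "i < length env \<Longrightarrow> eval P env (Var i) (env ! i) 1"
| eval_Quote: "eval P env (Quote v) v 1"
| eval_MkNode: "\<lbrakk>eval P env e\<^sub>1 v\<^sub>1 t\<^sub>1; eval P env e\<^sub>2 v\<^sub>2 t\<^sub>2\<rbrakk>
    \<Longrightarrow> eval P env (MkNode e\<^sub>1 e\<^sub>2) (Node v\<^sub>1 v\<^sub>2) (t\<^sub>1 + t\<^sub>2 + 1)"
| eval_LeftOf: "eval P env e v t \<Longrightarrow> eval P env (LeftOf e) (left v) (t + 1)"
| eval_RightOf: "eval P env e v t \<Longrightarrow> eval P env (RightOf e) (right v) (t + 1)"
| eval_IfNode_Node: "\<lbrakk>eval P env b (Node l r) t\<^sub>1; eval P env e\<^sub>1 v t\<^sub>2\<rbrakk>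
    \<Longrightarrow> eval P env (IfNode b e\<^sub>1 e\<^sub>2) v (t\<^sub>1 + t\<^sub>2 + 1)"
| eval_IfNode_Leaf: "\<lbrakk>eval P env b Leaf t\<^sub>1; eval P env e\<^sub>2 v t\<^sub>2\<rbrakk>
    \<Longrightarrow> eval P env (IfNode b e\<^sub>1 e\<^sub>2) v (t\<^sub>1 + t\<^sub>2 + 1)"
| eval_LetIn: "\<lbrakk>eval P env e\<^sub>1 u t\<^sub>1; eval P (u # env) e\<^sub>2 v t\<^sub>2\<rbrakk>
    \<Longrightarrow> eval P env (LetIn e\<^sub>1 e\<^sub>2) v (t\<^sub>1 + t\<^sub>2 + 1)"
| eval_Call: "\<lbrakk>i < length P; evals P env es vs t\<^sub>1; eval P vs (P ! i) v t\<^sub>2\<rbrakk>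
    \<Longrightarrow> eval P env (Call i es) v (t\<^sub>1 + t\<^sub>2 + 1)"
| evals_Nil: "evals P env [] [] 0"
| evals_Cons: "\<lbrakk>eval P env e v t\<^sub>1; evals P env es vs t\<^sub>2\<rbrakk>
    \<Longrightarrow> evals P env (e # es) (v # vs) (t\<^sub>1 + t\<^sub>2)"

inductive_simps eval_simps:
  "eval P env (Var i) v t"
  "eval P env (Quote c) v t"
  "eval P env (MkNode e\<^sub>1 e\<^sub>2) v t"
  "eval P env (LeftOf e) v t"
  "eval P env (RightOf e) v t"
  "eval P env (IfNode b e\<^sub>1 e\<^sub>2) v t"
  "eval P env (LetIn e\<^sub>1 e\<^sub>2) v t"
  "eval P env (Call i es) v t"
  "evals P env [] vs t"
  "evals P env (e # es) vs t"

lemma eval_iff: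
  "eval P env e v t \<Longrightarrow> eval P env e v' t' \<longleftrightarrow> v' = v \<and> t' = t"
  "evals P env es vs t \<Longrightarrow> evals P env es vs' t' \<longleftrightarrow> vs' = vs \<and> t' = t"
  by (induction arbitrary: v' t' and vs' t' rule: eval_evals.inducts) (auto simp: eval_simps)

lemma eval_deterministic:
  assumes "eval P env e v t" and "eval P env e v' t'"
  shows "v' = v" and "t' = t"
  using assms by (simp_all add: eval_iff)

text \<open>The main function is function 0; it receives the input as its only argument.\<close>

definition runs :: "prog \<Rightarrow> tree \<Rightarrow> tree \<Rightarrow> nat \<Rightarrow> bool" where
  "runs P x y t \<longleftrightarrow> eval P [] (Call 0 [Quote x]) y t"

definition enc_nat :: "nat \<Rightarrow> tree" where
  "enc_nat n = (Node Leaf ^^ n) Leaf"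

definition enc_list :: "('a \<Rightarrow> tree) \<Rightarrow> 'a list \<Rightarrow> tree" where
  "enc_list enc xs = foldr (\<lambda>x. Node (enc x)) xs Leaf"

definition computable :: "(nat \<Rightarrow> nat) \<Rightarrow> bool" where
  "computable f \<longleftrightarrow> (\<exists>P. \<forall>k. \<exists>t. runs P (enc_nat k) (enc_nat (f k)) t)"


section \<open>Fixed-parameter tractability\<close>

text \<open>
  A parameterized problem is given by its inputs \<open>X\<close>, their encoding, the parameter \<open>\<kappa>\<close> and the
  yes-inputs \<open>Q\<close>. A single program must decide all inputs in time \<open>f(k) n\<^sup>c\<close>, with \<open>n\<close> the number
  of leaves of the encoded input, which is one more than its \<open>size\<close>. A result other than \<open>Leaf\<close>
  means yes.
\<close>

definition fpt ::
  "'x set \<Rightarrow> ('x \<Rightarrow> tree) \<Rightarrow> ('x \<Rightarrow> nat) \<Rightarrow> ('x \<Rightarrow> bool) \<Rightarrow> bool" where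
  "fpt X enc \<kappa> Q \<longleftrightarrow>
    (\<exists>P f c. computable f \<and>
      (\<forall>x\<in>X. \<exists>y t. runs P (enc x) y t \<and> t \<le> f (\<kappa> x) * Suc (size (enc x)) ^ c
        \<and> (y \<noteq> Leaf \<longleftrightarrow> Q x)))"


section \<open>Relations and constraint languages\<close>

text \<open>The arity is recorded explicitly, so that the empty relation has one as well.\<close>

datatype 'd relation = Relation (arity: nat) (tuples: "'d list set")

definition relation_on :: "'d set \<Rightarrow> 'd relation \<Rightarrow> bool" where
  "relation_on D R \<longleftrightarrow> tuples R \<subseteq> {t. length t = arity R \<and> set t \<subseteq> D}"

definition constraint_language :: "'d set \<Rightarrow> 'd relation set \<Rightarrow> bool" where
  "constraint_language D \<Gamma> \<longleftrightarrow> finite \<Gamma> \<and> (\<forall>R\<in>\<Gamma>. relation_on D R)"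

definition zero_valid :: "'d \<Rightarrow> 'd relation \<Rightarrow> bool" where
  "zero_valid z R \<longleftrightarrow> replicate (arity R) z \<in> tuples R"

text \<open>The partial map \<open>\<sigma>\<close> sends the substituted coordinates to the constants put there.\<close>

definition substitute :: "'d relation \<Rightarrow> (nat \<rightharpoonup> 'd) \<Rightarrow> 'd relation" where
  "substitute R \<sigma> = Relation (card ({..<arity R} - dom \<sigma>))
    {nths t (- dom \<sigma>) | t. t \<in> tuples R \<and> (\<forall>i\<in>dom \<sigma>. \<sigma> i = Some (t ! i))}"

text \<open>
  Closure is only demanded for substitutions that leave at least one coordinate, so a language need
  not contain the nullary relation (but it may).
\<close>

definition cc0_language :: "'d set \<Rightarrow> 'd \<Rightarrow> 'd relation set \<Rightarrow> bool" where
  "cc0_language D z \<Gamma> \<longleftrightarrow> constraint_language D \<Gamma> \<and> (\<forall>R\<in>\<Gamma>. zero_valid z R) \<and>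
    (\<forall>R\<in>\<Gamma>. \<forall>\<sigma>. dom \<sigma> \<subset> {..<arity R} \<longrightarrow> ran \<sigma> \<subseteq> D \<longrightarrow>
      zero_valid z (substitute R \<sigma>) \<longrightarrow> substitute R \<sigma> \<in> \<Gamma>)"

definition disjoint_tuples :: "'d \<Rightarrow> 'd list \<Rightarrow> 'd list \<Rightarrow> bool" where
  "disjoint_tuples z s t \<longleftrightarrow> length s = length t \<and> (\<forall>i<length s. s ! i = z \<or> t ! i = z)"

text \<open>Only meaningful on disjoint tuples.\<close>

definition tuple_union :: "'d \<Rightarrow> 'd list \<Rightarrow> 'd list \<Rightarrow> 'd list" where
  "tuple_union z s t = map2 (\<lambda>a b. if a = z then b else a) s t"

definition weakly_separable_relation :: "'d \<Rightarrow> 'd relation \<Rightarrow> bool" where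
  "weakly_separable_relation z R \<longleftrightarrow>
    (\<forall>t\<^sub>1 t\<^sub>2. disjoint_tuples z t\<^sub>1 t\<^sub>2 \<longrightarrow>
      (t\<^sub>1 \<in> tuples R \<and> t\<^sub>2 \<in> tuples R \<longrightarrow> tuple_union z t\<^sub>1 t\<^sub>2 \<in> tuples R) \<and>
      (t\<^sub>2 \<in> tuples R \<and> tuple_union z t\<^sub>1 t\<^sub>2 \<in> tuples R \<longrightarrow> t\<^sub>1 \<in> tuples R))"

definition weakly_separable :: "'d \<Rightarrow> 'd relation set \<Rightarrow> bool" where
  "weakly_separable z \<Gamma> \<longleftrightarrow> (\<forall>R\<in>\<Gamma>. weakly_separable_relation z R)"


section \<open>Constraint satisfaction\<close>

type_synonym ('v, 'd) constraint = "'v list \<times> 'd relation"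

definition csp_instance ::
  "'d relation set \<Rightarrow> 'v set \<Rightarrow> ('v, 'd) constraint set \<Rightarrow> bool" where
  "csp_instance \<Gamma> V C \<longleftrightarrow> finite V \<and> finite C \<and>
    (\<forall>(s, R)\<in>C. R \<in> \<Gamma> \<and> length s = arity R \<and> set s \<subseteq> V)"

definition satisfying ::
  "'d set \<Rightarrow> 'v set \<Rightarrow> ('v, 'd) constraint set \<Rightarrow> ('v \<Rightarrow> 'd) \<Rightarrow> bool" where
  "satisfying D V C \<tau> \<longleftrightarrow> \<tau> \<in> V \<rightarrow> D \<and> (\<forall>(s, R)\<in>C. map \<tau> s \<in> tuples R)"

definition assignment_size :: "'d \<Rightarrow> 'v set \<Rightarrow> ('v \<Rightarrow> 'd) \<Rightarrow> nat" where
  "assignment_size z V \<tau> = card {v \<in> V. \<tau> v \<noteq> z}"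

definition ocsp_solvable ::
  "'d set \<Rightarrow> 'd \<Rightarrow> 'v set \<Rightarrow> ('v, 'd) constraint set \<Rightarrow> nat \<Rightarrow> bool" where
  "ocsp_solvable D z V C k \<longleftrightarrow> (\<exists>\<tau>. satisfying D V C \<tau> \<and> assignment_size z V \<tau> = k)"

definition ccsp_solvable ::
  "'d set \<Rightarrow> 'd \<Rightarrow> 'v set \<Rightarrow> ('v, 'd) constraint set \<Rightarrow> ('d \<Rightarrow> nat) \<Rightarrow> bool" where
  "ccsp_solvable D z V C \<pi> \<longleftrightarrow>
    (\<exists>\<tau>. satisfying D V C \<tau> \<and> (\<forall>a\<in>D - {z}. card {v \<in> V. \<tau> v = a} = \<pi> a))"


section \<open>The problems as parameterized problems\<close>

text \<open>
  As an input to a program, an instance has the variables \<open>0, \<dots>, n - 1\<close> and lists its constraints.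
  The language is fixed, so a relation is denoted by its number \<open>\<rho> R\<close>. Numbers are in unary, which
  for the instance changes the input size only polynomially.
\<close>

type_synonym 'd input_instance = "nat \<times> (nat, 'd) constraint list"

definition input_instance :: "'d relation set \<Rightarrow> 'd input_instance \<Rightarrow> bool" where
  "input_instance \<Gamma> = (\<lambda>(n, cs). csp_instance \<Gamma> {..<n} (set cs))"

definition enc_constraint :: "('d relation \<Rightarrow> nat) \<Rightarrow> (nat, 'd) constraint \<Rightarrow> tree" where
  "enc_constraint \<rho> = (\<lambda>(s, R). Node (enc_nat (\<rho> R)) (enc_list enc_nat s))"

definition enc_instance :: "('d relation \<Rightarrow> nat) \<Rightarrow> 'd input_instance \<Rightarrow> tree" where
  "enc_instance \<rho> = (\<lambda>(n, cs). Node (enc_nat n) (enc_list (enc_constraint \<rho>) cs))"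

text \<open>Tractability is required for every numbering of the relations and of the nonzero values.\<close>

definition ocsp_fpt :: "'d set \<Rightarrow> 'd \<Rightarrow> 'd relation set \<Rightarrow> bool" where
  "ocsp_fpt D z \<Gamma> \<longleftrightarrow> (\<forall>\<rho>. inj_on \<rho> \<Gamma> \<longrightarrow>
    fpt {(I, k). input_instance \<Gamma> I}
      (\<lambda>(I, k). Node (enc_instance \<rho> I) (enc_nat k))
      (\<lambda>(I, k). k)
      (\<lambda>((n, cs), k). ocsp_solvable D z {..<n} (set cs) k))"

definition ccsp_fpt :: "'d set \<Rightarrow> 'd \<Rightarrow> 'd relation set \<Rightarrow> bool" where
  "ccsp_fpt D z \<Gamma> \<longleftrightarrow> (\<forall>\<rho> as. inj_on \<rho> \<Gamma> \<longrightarrow> distinct as \<longrightarrow> set as = D - {z} \<longrightarrow>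
    fpt {(I, \<pi>, k). input_instance \<Gamma> I \<and> k = (\<Sum>a\<in>D - {z}. \<pi> a)}
      (\<lambda>(I, \<pi>, k). Node (enc_instance \<rho> I) (Node (enc_list (enc_nat \<circ> \<pi>) as) (enc_nat k)))
      (\<lambda>(I, \<pi>, k). k)
      (\<lambda>((n, cs), \<pi>, k). ccsp_solvable D z {..<n} (set cs) \<pi>))"

end

theory Submission imports Defs begin

text \<open>
  A bounded search tree finds satisfying assignments: as long as a constraint is violated by the
  current assignment, one of the zero variables in its scope must become nonzero. A leaf is an
  assignment found from a single nonzero variable. By weak separability a satisfying \<open>g\<close> contained
  in a satisfying \<open>f\<close> can be removed from \<open>f\<close>, and satisfying assignments with disjoint supports can
  be added.

  Let \<open>W\<close> be the variables of a greedily chosen family of disjoint leaves, with at most \<open>k + 1\<close>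
  members for each sequence of values. Among the solutions with the required numbers of
  values take one, \<open>f\<close>, whose support meets \<open>W\<close> in as many variables as possible. Every nonzero
  satisfying part of \<open>f\<close> meets \<open>W\<close>: otherwise it contains a leaf avoiding \<open>W\<close>, so the family has
  \<open>k + 1\<close> leaves with the same values, one of them is disjoint from the rest of \<open>f\<close>, and exchanging
  the two leaves gives a better solution. Hence \<open>f\<close> is found by a search that branches over a violated
  constraint if there is one and over \<open>W\<close> otherwise. The size of \<open>W\<close> depends on \<open>k\<close> only.
\<close>

section \<open>Running programs\<close>

text \<open>Once no constraint is violated, nothing local tells where the remaining nonzero
  variables are, and trying all \<open>n\<close> variables at each such point would cost about
  \<open>n ^ k\<close>. The number of leaves also grows with \<open>n\<close>, so they cannot all be
  kept. They are pooled by their sequence of values because exchanging two leaves with the same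
  sequence preserves the number of occurrences of every value, hence also the size: this is what the
  two problems prescribe.

  On the machine side two bounds are kept apart. \<open>b\<close> bounds the width of the branching
  and enters the base of a power with exponent \<open>k\<close>, so it has to be a function of
  \<open>k\<close> alone. \<open>L\<close> bounds all lengths and numbers; it may contain the input
  size, since it occurs only with fixed exponents. The list of visited assignments is never built:
  the program folds over it, so that the same search code first collects leaves and later tests
  candidates.\<close>

definition call :: "prog \<Rightarrow> nat \<Rightarrow> tree list \<Rightarrow> tree \<Rightarrow> nat \<Rightarrow> bool" where
  "call P i vs v t \<longleftrightarrow> i < length P \<and> eval P vs (P ! i) v t"

definition calls_in :: "prog \<Rightarrow> nat \<Rightarrow> tree list \<Rightarrow> tree \<Rightarrow> nat \<Rightarrow> bool" where
  "calls_in P i vs v T \<longleftrightarrow> (\<exists>t\<le>T. call P i vs v t)"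

text \<open>\<open>call\<close> stays opaque here: simplification with \<open>run_simps\<close>
  executes one function body and stops at every call, whereas unfolding \<open>P ! i\<close> need
  not end for a recursive function.\<close>

lemma eval_Call_iff:
  "eval P env (Call i es) v t \<longleftrightarrow>
    (\<exists>vs t\<^sub>1 t\<^sub>2. t = t\<^sub>1 + t\<^sub>2 + 1 \<and> evals P env es vs t\<^sub>1 \<and> call P i vs v t\<^sub>2)"
  by (auto simp: eval_simps(8) call_def)

lemmas run_simps = eval_simps(1-7,9,10) eval_Call_iff

lemma call_iff: "call P i vs v t \<Longrightarrow> call P i vs v' t' \<longleftrightarrow> v' = v \<and> t' = t"
  by (auto simp: call_def eval_iff)

lemma calls_inI:
  assumes "i < length P" and "P ! i = e" and "\<exists>t. eval P vs e v t \<and> t \<le> T"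
  shows "calls_in P i vs v T"
  using assms by (auto simp: calls_in_def call_def)

text \<open>Evaluation is deterministic, so one known run becomes an equivalence in
  \<open>v'\<close> and \<open>t'\<close>. Used as a rewrite rule, it lets the simplifier replace a
  call by its result.\<close>

lemma calls_inE:
  assumes "calls_in P i vs v T"
  obtains t where "t \<le> T" and "\<And>v' t'. call P i vs v' t' \<longleftrightarrow> v' = v \<and> t' = t"
  using assms by (auto simp: calls_in_def call_def eval_iff)

lemma calls_in_mono: "calls_in P i vs v T \<Longrightarrow> T \<le> T' \<Longrightarrow> calls_in P i vs v T'"
  unfolding calls_in_def by (meson order_trans)

lemma enc_nat_simps [simp]: "enc_nat 0 = Leaf" "enc_nat (Suc n) = Node Leaf (enc_nat n)"
  by (simp_all add: enc_nat_def)

lemma enc_list_simps [simp]: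
  "enc_list enc [] = Leaf" "enc_list enc (x # xs) = Node (enc x) (enc_list enc xs)"
  by (simp_all add: enc_list_def)

lemma size_enc_nat [simp]: "size (enc_nat n) = n"
  by (induction n) auto

lemma length_le_size_enc_list: "length xs \<le> size (enc_list enc xs)"
  by (induction xs) auto

text \<open>The right spine has as many nodes as a unary number has units and as a list has entries,
  so one comparison function serves for numbers and for lengths of lists.\<close>

fun rdepth :: "tree \<Rightarrow> nat" where
  "rdepth Leaf = 0"
| "rdepth (Node l r) = Suc (rdepth r)"

lemma rdepth_enc_nat [simp]: "rdepth (enc_nat n) = n"
  by (induction n) auto

lemma rdepth_enc_list [simp]: "rdepth (enc_list enc xs) = length xs"
  by (induction xs) auto

definition enc_bool :: "bool \<Rightarrow> tree" where
  "enc_bool b = (if b then Node Leaf Leaf else Leaf)"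

lemma enc_bool_simps [simp]: "enc_bool True = Node Leaf Leaf" "enc_bool False = Leaf"
  by (simp_all add: enc_bool_def)


lemma enc_bool_eq_Leaf [simp]: "enc_bool b = Leaf \<longleftrightarrow> \<not> b"
  by (simp add: enc_bool_def)


section \<open>Elementary functions are computable\<close>

text \<open>\<open>fpt\<close> asks for a computable \<open>f\<close>. Writing the time bound in
  this small syntax reduces its computability to a structural induction.\<close>

datatype arith = Const nat | Param | Add arith arith | Mult arith arith | Power arith arith

fun arith_val :: "arith \<Rightarrow> nat \<Rightarrow> nat" where
  "arith_val (Const c) k = c"
| "arith_val Param k = k"
| "arith_val (Add a b) k = arith_val a k + arith_val b k"
| "arith_val (Mult a b) k = arith_val a k * arith_val b k"
| "arith_val (Power a b) k = arith_val a k ^ arith_val b k"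

fun arith_expr :: "arith \<Rightarrow> expr" where
  "arith_expr (Const c) = Quote (enc_nat c)"
| "arith_expr Param = Var 0"
| "arith_expr (Add a b) = Call 1 [arith_expr a, arith_expr b]"
| "arith_expr (Mult a b) = Call 2 [arith_expr a, arith_expr b]"
| "arith_expr (Power a b) = Call 3 [arith_expr a, arith_expr b]"

definition arith_prog :: "arith \<Rightarrow> prog" where
  "arith_prog a =
   [arith_expr a,
    IfNode (Var 0) (MkNode (Quote Leaf) (Call 1 [RightOf (Var 0), Var 1])) (Var 1),
    IfNode (Var 0) (Call 1 [Var 1, Call 2 [RightOf (Var 0), Var 1]]) (Quote Leaf),
    IfNode (Var 1) (Call 2 [Var 0, Call 3 [Var 0, RightOf (Var 1)]]) (Quote (enc_nat 1))]"

lemma computable_arith: "computable (arith_val a)"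
proof -
  define P where "P = arith_prog a"
  have len: "length P = 4" and main: "P ! 0 = arith_expr a"
    and body1: "P ! Suc 0 = IfNode (Var 0) (MkNode (Quote Leaf) (Call 1 [RightOf (Var 0), Var 1])) (Var 1)"
    and body2: "P ! 2 = IfNode (Var 0) (Call 1 [Var 1, Call 2 [RightOf (Var 0), Var 1]]) (Quote Leaf)"
    and body3: "P ! 3 = IfNode (Var 1) (Call 2 [Var 0, Call 3 [Var 0, RightOf (Var 1)]]) (Quote (enc_nat 1))"
    by (simp_all add: P_def arith_prog_def)
  have add: "\<exists>t. call P 1 [enc_nat x, enc_nat y] (enc_nat (x + y)) t" for x y
  proof (induction x)
    case 0
    show ?case by (subst call_def) (simp add: len body1 run_simps)
  next
    case (Suc x)
    then obtain t where "call P 1 [enc_nat x, enc_nat y] (enc_nat (x + y)) t" by blast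
    note t = call_iff[OF this]
    show ?case
      using t by (subst call_def) (simp add: len body1 run_simps)
  qed
  have mult: "\<exists>t. call P 2 [enc_nat x, enc_nat y] (enc_nat (x * y)) t" for x y
  proof (induction x)
    case 0
    show ?case by (subst call_def) (simp add: len body2 run_simps)
  next
    case (Suc x)
    then obtain t where "call P 2 [enc_nat x, enc_nat y] (enc_nat (x * y)) t" by blast
    note t = call_iff[OF this]
    obtain t' where "call P 1 [enc_nat y, enc_nat (x * y)] (enc_nat (y + x * y)) t'"
      using add by blast
    note t' = call_iff[OF this]
    show ?case
      using t t' by (subst call_def) (simp add: len body2 run_simps)
  qed
  have power: "\<exists>t. call P 3 [enc_nat x, enc_nat y] (enc_nat (x ^ y)) t" for x y
  proof (induction y)
    case 0
    show ?case by (subst call_def) (simp add: len body3 run_simps)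
  next
    case (Suc y)
    then obtain t where "call P 3 [enc_nat x, enc_nat y] (enc_nat (x ^ y)) t" by blast
    note t = call_iff[OF this]
    obtain t' where "call P 2 [enc_nat x, enc_nat (x ^ y)] (enc_nat (x * x ^ y)) t'"
      using mult by blast
    note t' = call_iff[OF this]
    show ?case
      using t t' by (subst call_def) (simp add: len body3 run_simps)
  qed
  have "\<exists>t. eval P [enc_nat k] (arith_expr b) (enc_nat (arith_val b k)) t" for b k
  proof (induction b)
    case (Add b c)
    then obtain t\<^sub>1 t\<^sub>2 where "eval P [enc_nat k] (arith_expr b) (enc_nat (arith_val b k)) t\<^sub>1"
      "eval P [enc_nat k] (arith_expr c) (enc_nat (arith_val c k)) t\<^sub>2" by blast
    note args = this[THEN eval_iff(1)]
    obtain t where "call P 1 [enc_nat (arith_val b k), enc_nat (arith_val c k)]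
        (enc_nat (arith_val b k + arith_val c k)) t"
      using add by blast
    note op = call_iff[OF this]
    show ?case using args op by (simp add: run_simps)
  next
    case (Mult b c)
    then obtain t\<^sub>1 t\<^sub>2 where "eval P [enc_nat k] (arith_expr b) (enc_nat (arith_val b k)) t\<^sub>1"
      "eval P [enc_nat k] (arith_expr c) (enc_nat (arith_val c k)) t\<^sub>2" by blast
    note args = this[THEN eval_iff(1)]
    obtain t where "call P 2 [enc_nat (arith_val b k), enc_nat (arith_val c k)]
        (enc_nat (arith_val b k * arith_val c k)) t"
      using mult by blast
    note op = call_iff[OF this]
    show ?case using args op by (simp add: run_simps)
  next
    case (Power b c)
    then obtain t\<^sub>1 t\<^sub>2 where "eval P [enc_nat k] (arith_expr b) (enc_nat (arith_val b k)) t\<^sub>1"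
      "eval P [enc_nat k] (arith_expr c) (enc_nat (arith_val c k)) t\<^sub>2" by blast
    note args = this[THEN eval_iff(1)]
    obtain t where "call P 3 [enc_nat (arith_val b k), enc_nat (arith_val c k)]
        (enc_nat (arith_val b k ^ arith_val c k)) t"
      using power by blast
    note op = call_iff[OF this]
    show ?case using args op by (simp add: run_simps)
  qed (simp_all add: run_simps)
  then have main_eval: "\<exists>t. eval P [enc_nat k] (arith_expr a) (enc_nat (arith_val a k)) t" for k
    by blast
  have "\<exists>t. runs P (enc_nat k) (enc_nat (arith_val a k)) t" for k
  proof -
    obtain t where "eval P [enc_nat k] (arith_expr a) (enc_nat (arith_val a k)) t"
      using main_eval by blast
    note t = eval_iff(1)[OF this]
    show ?thesis
      using t by (simp add: runs_def run_simps call_def len main)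
  qed
  then show ?thesis
    unfolding computable_def by blast
qed

section \<open>Assignments and the search tree\<close>

text \<open>
  An assignment is an association list with pairwise distinct variables. Its values are numbers:
  \<open>0\<close> stands for the distinguished element, so it does not occur in the list.
\<close>

type_synonym assignment = "(nat \<times> nat) list"

definition lookup :: "assignment \<Rightarrow> nat \<Rightarrow> nat" where
  "lookup h x = (case map_of h x of None \<Rightarrow> 0 | Some a \<Rightarrow> a)"

lemma lookup_Nil [simp]: "lookup [] x = 0"
  by (simp add: lookup_def)

lemma lookup_Cons [simp]: "lookup ((y, a) # h) x = (if x = y then a else lookup h x)"
  by (simp add: lookup_def)

definition vars :: "assignment \<Rightarrow> nat set" where
  "vars h = fst ` set h"

lemma vars_simps [simp]: "vars [] = {}" "vars (p # h) = insert (fst p) (vars h)"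
  by (auto simp: vars_def)

lemma finite_vars [simp]: "finite (vars h)"
  by (simp add: vars_def)

lemma lookup_notin_vars: "x \<notin> vars h \<Longrightarrow> lookup h x = 0"
  by (induction h) auto

definition below :: "(nat \<Rightarrow> nat) \<Rightarrow> (nat \<Rightarrow> nat) \<Rightarrow> bool" (infix \<open>\<sqsubseteq>\<close> 50) where
  "g \<sqsubseteq> f \<longleftrightarrow> (\<forall>x. g x = 0 \<or> g x = f x)"

abbreviation supp :: "(nat \<Rightarrow> nat) \<Rightarrow> nat set" where
  "supp f \<equiv> {x. f x \<noteq> 0}"

lemma below_differ: "g \<sqsubseteq> f \<Longrightarrow> {x. g x \<noteq> f x} \<subseteq> supp f"
proof
  fix x
  assume "g \<sqsubseteq> f" and "x \<in> {x. g x \<noteq> f x}"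
  then have "g x = 0 \<or> g x = f x" "g x \<noteq> f x" unfolding below_def by blast+
  then show "x \<in> supp f" by (metis mem_Collect_eq)
qed

lemma below_trans: "f \<sqsubseteq> g \<Longrightarrow> g \<sqsubseteq> h \<Longrightarrow> f \<sqsubseteq> h"
  unfolding below_def by metis

lemma card_level_add:
  fixes f g :: "nat \<Rightarrow> nat"
  assumes "\<And>x. f x = 0 \<or> g x = 0" and "finite (supp f)" and "finite (supp g)" and "a \<noteq> 0"
  shows "card {x. f x + g x = a} = card {x. f x = a} + card {x. g x = a}"
proof -
  have "{x. f x + g x = a} = {x. f x = a} \<union> {x. g x = a}"
  proof (intro set_eqI)
    show "x \<in> {x. f x + g x = a} \<longleftrightarrow> x \<in> {x. f x = a} \<union> {x. g x = a}" for x
      using assms(1)[of x] \<open>a \<noteq> 0\<close> by auto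
  qed
  moreover have "f x \<noteq> a \<or> g x \<noteq> a" for x
    using assms(1)[of x] \<open>a \<noteq> 0\<close> by auto
  then have "{x. f x = a} \<inter> {x. g x = a} = {}" by blast
  moreover have "finite {x. f x = a}" "finite {x. g x = a}"
    using assms(2-4) by (auto elim: rev_finite_subset)
  ultimately show ?thesis
    by (simp add: card_Un_disjoint)
qed

lemma card_supp_levels:
  assumes "finite (supp f)" and "\<And>x. f x \<le> A"
  shows "card (supp f) = (\<Sum>a\<in>{1..A}. card {x. f x = a})"
proof -
  have eq: "supp f = (\<Union>a\<in>{1..A}. {x. f x = a})"
  proof (intro set_eqI)
    show "x \<in> supp f \<longleftrightarrow> x \<in> (\<Union>a\<in>{1..A}. {x. f x = a})" for x
      using assms(2)[of x] by auto
  qed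
  have "finite {x. f x = a}" if "a \<in> {1..A}" for a
    using that assms(1) by (auto elim: rev_finite_subset)
  then show ?thesis
    unfolding eq by (intro card_UN_disjoint) auto
qed

section \<open>Greedy families of disjoint leaves\<close>

definition same_type :: "assignment \<Rightarrow> assignment \<Rightarrow> bool" where
  "same_type g h \<longleftrightarrow> map snd g = map snd h"

text \<open>
  Pairwise disjoint assignments are collected, at most \<open>k + 1\<close> of each type: this many suffice
  to find one that avoids any given \<open>k\<close> variables.
\<close>

definition add_leaf :: "nat \<Rightarrow> assignment \<Rightarrow> assignment list \<Rightarrow> assignment list" where
  "add_leaf k g F = (if (\<forall>f\<in>set F. vars g \<inter> vars f = {}) \<and> length (filter (same_type g) F) \<le> k
     then g # F else F)"

lemma fold_add_leaf_subset: "set F \<subseteq> set (fold (add_leaf k) ls F)"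
proof (induction ls arbitrary: F)
  case (Cons l ls)
  have "set F \<subseteq> set (add_leaf k l F)" by (auto simp: add_leaf_def)
  then show ?case using Cons[of "add_leaf k l F"] by (simp add: subset_trans)
qed auto

lemma fold_add_leaf_filter_le:
  "length (filter P F) \<le> length (filter P (fold (add_leaf k) ls F))"
proof (induction ls arbitrary: F)
  case (Cons l ls)
  have "length (filter P F) \<le> length (filter P (add_leaf k l F))" by (auto simp: add_leaf_def)
  then show ?case using Cons[of "add_leaf k l F"] by simp
qed auto

lemma set_fold_add_leaf: "set (fold (add_leaf k) ls F) \<subseteq> set ls \<union> set F"
proof (induction ls arbitrary: F)
  case (Cons l ls)
  have "set (add_leaf k l F) \<subseteq> insert l (set F)" by (auto simp: add_leaf_def)
  then show ?case using Cons[of "add_leaf k l F"] by auto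
qed auto

lemma disjoint_add_leaf:
  "sorted_wrt (\<lambda>f g. vars f \<inter> vars g = {}) F \<Longrightarrow>
    sorted_wrt (\<lambda>f g. vars f \<inter> vars g = {}) (add_leaf k g F)"
  by (auto simp: add_leaf_def)

lemma disjoint_fold_add_leaf:
  "sorted_wrt (\<lambda>f g. vars f \<inter> vars g = {}) F \<Longrightarrow>
    sorted_wrt (\<lambda>f g. vars f \<inter> vars g = {}) (fold (add_leaf k) ls F)"
  by (induction ls arbitrary: F) (auto simp: disjoint_add_leaf)

text \<open>The family only grows, so what holds right after \<open>l\<close> has been offered
  remains true. If \<open>l\<close> was taken, the member it meets is \<open>l\<close> itself, which
  is where \<open>vars l\<close> has to be nonempty; if it was refused, it met a member or its type
  was full.\<close>

lemma fold_add_leaf_complete: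
  assumes "l \<in> set ls" and "vars l \<noteq> {}"
  shows "(\<exists>f\<in>set (fold (add_leaf k) ls F). vars l \<inter> vars f \<noteq> {}) \<or>
    k < length (filter (same_type l) (fold (add_leaf k) ls F))"
  using assms(1)
proof (induction ls arbitrary: F)
  case (Cons l' ls)
  show ?case
  proof (cases "l' = l")
    case True
    let ?F = "add_leaf k l F"
    have "(\<exists>f\<in>set ?F. vars l \<inter> vars f \<noteq> {}) \<or> k < length (filter (same_type l) ?F)"
      using assms(2) by (auto simp: add_leaf_def)
    moreover have "set ?F \<subseteq> set (fold (add_leaf k) ls ?F)"
      "length (filter (same_type l) ?F) \<le> length (filter (same_type l) (fold (add_leaf k) ls ?F))"
      by (rule fold_add_leaf_subset fold_add_leaf_filter_le)+
    ultimately show ?thesis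
      using True by (auto dest: less_le_trans)
  next
    case False
    then show ?thesis using Cons by auto
  qed
qed auto

definition few_of_each_type :: "nat \<Rightarrow> assignment list \<Rightarrow> bool" where
  "few_of_each_type k F \<longleftrightarrow> (\<forall>t. length (filter (\<lambda>f. map snd f = t) F) \<le> Suc k)"

lemma few_of_each_type_add_leaf: "few_of_each_type k F \<Longrightarrow> few_of_each_type k (add_leaf k g F)"
proof -
  have "same_type g = (\<lambda>f. map snd f = map snd g)" by (auto simp: same_type_def)
  then show "few_of_each_type k F \<Longrightarrow> ?thesis"
    by (auto simp: few_of_each_type_def add_leaf_def)
qed

lemma length_eq_sum_filter:
  assumes "finite T" and "p ` set F \<subseteq> T"
  shows "length F = (\<Sum>t\<in>T. length (filter (\<lambda>f. p f = t) F))"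
  using assms(2)
proof (induction F)
  case (Cons f F)
  have "(\<Sum>t\<in>T. length (filter (\<lambda>f. p f = t) (f # F))) =
      (\<Sum>t\<in>T. (if p f = t then 1 else 0) + length (filter (\<lambda>f. p f = t) F))"
    by (intro sum.cong) auto
  also have "\<dots> = 1 + (\<Sum>t\<in>T. length (filter (\<lambda>f. p f = t) F))"
    using Cons.prems \<open>finite T\<close> by (simp add: sum.distrib)
  finally show ?case using Cons by simp
qed auto

text \<open>Padding with one extra letter embeds the words of length at most \<open>m\<close> over
  \<open>A\<close> letters into the words of length \<open>m\<close> over \<open>Suc A\<close>
  letters.\<close>

lemma sum_power_le: "(\<Sum>i\<le>m. A ^ i) \<le> Suc A ^ m" for A m :: nat
proof (induction m)
  case (Suc m)
  have "A ^ m \<le> Suc A ^ m" by (intro power_mono) auto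
  then have "A * A ^ m \<le> A * Suc A ^ m" by (rule mult_le_mono2)
  note add_mono[OF Suc this]
  then show ?case by simp
qed auto

text \<open>Types are words of length at most \<open>Suc k\<close> over \<open>{1..A}\<close>; there
  are at most \<open>Suc A ^ Suc k\<close> of them, and each has at most \<open>Suc k\<close>
  members.\<close>

lemma length_few_of_each_type:
  assumes "few_of_each_type k F" and "\<And>f. f \<in> set F \<Longrightarrow> length f \<le> Suc k \<and> snd ` set f \<subseteq> {1..A}"
  shows "length F \<le> Suc k * Suc A ^ Suc k"
proof -
  let ?T = "{t. set t \<subseteq> {1..A} \<and> length t \<le> Suc k}"
  have "length F = (\<Sum>t\<in>?T. length (filter (\<lambda>f. map snd f = t) F))"
    using assms(2) by (intro length_eq_sum_filter) (force simp: finite_lists_length_le)+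
  also have "\<dots> \<le> (\<Sum>t\<in>?T. Suc k)"
    using assms(1) by (intro sum_mono) (auto simp: few_of_each_type_def)
  also have "\<dots> = Suc k * (\<Sum>i\<le>Suc k. A ^ i)"
    by (simp add: card_lists_length_le del: sum.atMost_Suc)
  also have "\<dots> \<le> Suc k * Suc A ^ Suc k"
    by (intro mult_le_mono2 sum_power_le)
  finally show ?thesis .
qed

lemma disjoint_list_pigeonhole:
  assumes "sorted_wrt (\<lambda>f g. vars f \<inter> vars g = {}) F" and "finite S" and "card S < length F"
  shows "\<exists>f\<in>set F. vars f \<inter> S = {}"
  using assms
proof (induction F arbitrary: S)
  case (Cons f F)
  show ?case
  proof (cases "vars f \<inter> S = {}")
    case False
    then obtain x where x: "x \<in> vars f" "x \<in> S" by auto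
    then have "card (S - {x}) < length F"
      using Cons.prems by (simp add: card_Diff_singleton_if)
        (metis card_gt_0_iff empty_iff less_Suc_eq_0_disj not_less_eq Suc_pred)
    then obtain g where "g \<in> set F" "vars g \<inter> (S - {x}) = {}"
      using Cons.IH[of "S - {x}"] Cons.prems by auto
    moreover have "x \<notin> vars g"
      using Cons.prems(1) x(1) \<open>g \<in> set F\<close> by auto
    ultimately show ?thesis by auto
  qed auto
qed auto

text \<open>The recursive call \<open>r\<close> and the list \<open>s\<close> are parameters because
  three branchings share this form: over the scope of a violated constraint, over \<open>W\<close>,
  and over all variables when a leaf is started.\<close>

definition expand ::
  "nat \<Rightarrow> (assignment \<Rightarrow> assignment list) \<Rightarrow> nat list \<Rightarrow> assignment \<Rightarrow> assignment list" where
  "expand A r s h = concat (map (\<lambda>x. if lookup h x \<noteq> 0 then []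
     else concat (map (\<lambda>a. r ((x, a) # h)) [1..<Suc A])) s)"

lemma set_expand:
  "set (expand A r s h) = (\<Union>x\<in>{x \<in> set s. lookup h x = 0}. \<Union>a\<in>{1..A}. set (r ((x, a) # h)))"
  by (auto simp: expand_def atLeastLessThanSuc_atLeastAtMost simp del: upt_Suc split: if_splits)

definition wf_assignment :: "nat \<Rightarrow> nat \<Rightarrow> assignment \<Rightarrow> bool" where
  "wf_assignment A n h \<longleftrightarrow> distinct (map fst h) \<and> vars h \<subseteq> {..<n} \<and> snd ` set h \<subseteq> {1..A}"

lemma wf_assignment_Nil [simp]: "wf_assignment A n []"
  by (simp add: wf_assignment_def)

lemma wf_lookup_eq_0: "wf_assignment A n h \<Longrightarrow> lookup h x = 0 \<longleftrightarrow> x \<notin> vars h"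
  by (induction h) (auto simp: wf_assignment_def split: if_splits)

lemma wf_lookup_le: "wf_assignment A n h \<Longrightarrow> lookup h x \<le> A"
  by (induction h) (auto simp: wf_assignment_def)

lemma wf_assignment_Cons:
  assumes "wf_assignment A n h" and "lookup h x = 0" and "x < n" and "a \<in> {1..A}"
  shows "wf_assignment A n ((x, a) # h)"
  using assms wf_lookup_eq_0[OF assms(1), of x] by (auto simp: wf_assignment_def vars_def)

lemma card_lookup_level:
  assumes "wf_assignment A n h" and "a \<noteq> 0"
  shows "card {x. lookup h x = a} = count_list (map snd h) a"
  using assms(1)
proof (induction h)
  case (Cons p h)
  obtain y b where p: "p = (y, b)" by fastforce
  have wf: "wf_assignment A n h" and y: "lookup h y = 0"
    using Cons.prems by (auto simp: p wf_assignment_def lookup_notin_vars vars_def)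
  have "finite (supp (lookup h))"
    by (rule finite_subset[OF _ finite_vars[of h]]) (auto intro: ccontr simp: lookup_notin_vars)
  then have fin: "finite {x. lookup h x = a}"
    using \<open>a \<noteq> 0\<close> by (auto elim: rev_finite_subset)
  have "{x. lookup (p # h) x = a} = (if b = a then insert y {x. lookup h x = a} else {x. lookup h x = a})"
    using y \<open>a \<noteq> 0\<close> by (auto simp: p)
  then show ?case
    using Cons.IH[OF wf] y \<open>a \<noteq> 0\<close> fin by (auto simp: p)
qed (use \<open>a \<noteq> 0\<close> in auto)


section \<open>Weak separability and the exchange argument\<close>

locale weak_language =
  fixes D :: "'d set" and z :: 'd and \<Gamma> :: "'d relation set" and vals :: "'d list"
  assumes z_in: "z \<in> D" and weakly_separable: "weakly_separable z \<Gamma>"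
    and distinct_vals: "distinct vals" and set_vals: "set vals = D - {z}"
begin

definition val :: "nat \<Rightarrow> 'd" where
  "val i = (z # vals) ! i"

abbreviation A :: nat where
  "A \<equiv> length vals"

lemma val_0 [simp]: "val 0 = z"
  by (simp add: val_def)

lemma val_Suc [simp]: "val (Suc i) = vals ! i"
  by (simp add: val_def)

lemma val_inj: "i \<le> A \<Longrightarrow> j \<le> A \<Longrightarrow> val i = val j \<longleftrightarrow> i = j"
  using distinct_vals set_vals unfolding val_def
  by (intro nth_eq_iff_index_eq) auto

lemma val_eq_z: "i \<le> A \<Longrightarrow> val i = z \<longleftrightarrow> i = 0"
  using val_inj[of i 0] by simp

lemma range_val: "val ` {..A} = D"
proof -
  have "val ` {..<length (z # vals)} = set (z # vals)"
    unfolding val_def set_conv_nth[of "z # vals"] by (auto simp: image_iff)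
  then show ?thesis
    using set_vals z_in by (auto simp: lessThan_Suc_atMost)
qed

definition sat :: "(nat, 'd) constraint list \<Rightarrow> (nat \<Rightarrow> nat) \<Rightarrow> bool" where
  "sat cs f \<longleftrightarrow> (\<forall>c\<in>set cs. map (\<lambda>x. val (f x)) (fst c) \<in> tuples (snd c))"

definition violated :: "(nat, 'd) constraint list \<Rightarrow> assignment \<Rightarrow> (nat, 'd) constraint option" where
  "violated cs h = find (\<lambda>c. map (\<lambda>x. val (lookup h x)) (fst c) \<notin> tuples (snd c)) cs"

lemma violated_None: "violated cs h = None \<longleftrightarrow> sat cs (lookup h)"
  by (auto simp: violated_def sat_def find_None_iff)

lemma violated_Some:
  assumes "violated cs h = Some c"
  shows "c \<in> set cs" and "map (\<lambda>x. val (lookup h x)) (fst c) \<notin> tuples (snd c)"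
  using assms by (auto simp: violated_def find_Some_iff)

text \<open>\<open>j\<close> is the number of variables that may still become nonzero. With
  \<open>W = []\<close> a satisfying node has no children, so every branch ends at its first
  satisfying assignment; this gives the leaves. With the kernel as \<open>W\<close> the search
  continues below such a node.\<close>

primrec visits ::
  "(nat, 'd) constraint list \<Rightarrow> nat list \<Rightarrow> nat \<Rightarrow> assignment \<Rightarrow> assignment list" where
  "visits cs W 0 h = (case violated cs h of None \<Rightarrow> [h] | Some c \<Rightarrow> [])"
| "visits cs W (Suc j) h = (case violated cs h of
     None \<Rightarrow> h # expand A (visits cs W j) W h
   | Some c \<Rightarrow> expand A (visits cs W j) (fst c) h)"

lemma visits_sat: "g \<in> set (visits cs W j h) \<Longrightarrow> sat cs (lookup g)"
  by (induction j arbitrary: h)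
    (auto simp: set_expand violated_None[symmetric] split: option.splits)

lemma vars_visits: "g \<in> set (visits cs W j h) \<Longrightarrow> vars h \<subseteq> vars g"
proof (induction j arbitrary: h)
  case (Suc j)
  have "vars h \<subseteq> vars g" if "g \<in> set (expand A (visits cs W j) s h)" for s
    using that Suc.IH[of "(_, _) # h"] by (fastforce simp: set_expand)
  then show ?case
    using Suc.prems by (auto split: option.splits)
qed (auto split: option.splits)

lemma visits_wf:
  assumes "\<And>c. c \<in> set cs \<Longrightarrow> set (fst c) \<subseteq> {..<n}" and "set W \<subseteq> {..<n}"
    and "wf_assignment A n h" and "g \<in> set (visits cs W j h)"
  shows "wf_assignment A n g \<and> length g \<le> length h + j"
  using assms(3,4)
proof (induction j arbitrary: h)
  case (Suc j)
  define s where "s = (case violated cs h of None \<Rightarrow> W | Some c \<Rightarrow> fst c)"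
  have "set s \<subseteq> {..<n}"
    using assms(1,2) violated_Some(1)[of cs h] by (auto simp: s_def split: option.splits)
  moreover have "g = h \<or> g \<in> set (expand A (visits cs W j) s h)"
    using Suc.prems(2) by (auto simp: s_def split: option.splits)
  ultimately consider "g = h" | x a where "x < n" "lookup h x = 0" "a \<in> {1..A}"
      "g \<in> set (visits cs W j ((x, a) # h))"
    by (auto simp: set_expand)
  then show ?case
  proof cases
    case 2
    then show ?thesis
      using Suc.IH[OF wf_assignment_Cons[OF Suc.prems(1)]] by simp
  qed (use Suc.prems(1) in auto)
qed (auto split: option.splits)

text \<open>The branch to follow is dictated by \<open>f\<close>. A violated constraint has a
  variable in its scope on which \<open>h\<close> and \<open>f\<close> differ, since
  \<open>f\<close> satisfies it; otherwise one continues as long as they differ on \<open>W\<close>.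
  Giving such a variable its value under \<open>f\<close> removes one disagreement, so the number of
  disagreements is enough fuel.\<close>

lemma visits_reach:
  assumes "sat cs f" and "\<And>x. f x \<le> A" and "finite (supp f)"
    and "lookup h \<sqsubseteq> f" and "card {x. lookup h x \<noteq> f x} \<le> j"
  shows "\<exists>g\<in>set (visits cs W j h). lookup h \<sqsubseteq> lookup g \<and> lookup g \<sqsubseteq> f \<and>
    (\<forall>w\<in>set W. lookup g w = f w)"
  using assms(4,5)
proof (induction j arbitrary: h)
  case 0
  have "finite {x. lookup h x \<noteq> f x}"
    using finite_subset[OF below_differ assms(3)] 0(1) by blast
  then have "lookup h = f"
    using 0(2) by auto
  then show ?case
    using assms(1) violated_None[of cs h] by (auto simp: below_def)
next
  case (Suc j)
  have fin: "finite {x. lookup h x \<noteq> f x}"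
    using finite_subset[OF below_differ assms(3)] Suc.prems(1) by blast
  define s where "s = (case violated cs h of None \<Rightarrow> W | Some c \<Rightarrow> fst c)"
  show ?case
  proof (cases "\<exists>x\<in>set s. lookup h x \<noteq> f x")
    case False
    have "violated cs h = None"
    proof (rule ccontr)
      assume "violated cs h \<noteq> None"
      then obtain c where c: "violated cs h = Some c" by auto
      with False have "map (\<lambda>x. val (lookup h x)) (fst c) = map (\<lambda>x. val (f x)) (fst c)"
        by (auto simp: s_def)
      then show False
        using violated_Some[OF c] assms(1) unfolding sat_def by metis
    qed
    then show ?thesis
      using False Suc.prems(1) by (auto simp: s_def below_def)
  next
    case True
    then obtain x where x: "x \<in> set s" "lookup h x \<noteq> f x" by auto
    then have x0: "lookup h x = 0" "f x \<noteq> 0"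
      using Suc.prems(1) unfolding below_def by metis+
    let ?h = "(x, f x) # h"
    have "{y. lookup ?h y \<noteq> f y} = {y. lookup h y \<noteq> f y} - {x}" by auto
    then have "card {y. lookup ?h y \<noteq> f y} \<le> j"
      using fin x(2) Suc.prems(2) by (simp add: card_Diff_singleton_if)
    moreover have "lookup ?h \<sqsubseteq> f"
      using Suc.prems(1) by (auto simp: below_def)
    ultimately obtain g where g: "g \<in> set (visits cs W j ?h)" "lookup ?h \<sqsubseteq> lookup g"
        "lookup g \<sqsubseteq> f" "\<forall>w\<in>set W. lookup g w = f w"
      using Suc.IH by blast
    have "lookup h \<sqsubseteq> lookup ?h"
      using x0 by (auto simp: below_def)
    with g(2) have "lookup h \<sqsubseteq> lookup g"
      by (blast intro: below_trans)
    moreover have "g \<in> set (expand A (visits cs W j) s h)"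
      using x x0 g(1) assms(2)[of x] by (fastforce simp: set_expand)
    then have "g \<in> set (visits cs W (Suc j) h)"
      by (auto simp: s_def split: option.splits)
    ultimately show ?thesis using g by blast
  qed
qed

section \<open>Adding and removing satisfying assignments\<close>

lemma map2_val:
  assumes "\<And>x. f x \<le> A" and "\<And>x. f x = 0 \<or> g x = 0"
  shows "tuple_union z (map (\<lambda>x. val (f x)) s) (map (\<lambda>x. val (g x)) s) =
    map (\<lambda>x. val (f x + g x)) s"
proof (induction s)
  case (Cons x s)
  then show ?case
    using assms(1)[of x] assms(2)[of x] by (auto simp: tuple_union_def val_eq_z)
qed (simp add: tuple_union_def)

lemma disjoint_val:
  assumes "\<And>x. f x = 0 \<or> g x = 0"
  shows "disjoint_tuples z (map (\<lambda>x. val (f x)) s) (map (\<lambda>x. val (g x)) s)"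
  unfolding disjoint_tuples_def using assms by (metis length_map nth_map val_0)

lemma sat_add:
  assumes "snd ` set cs \<subseteq> \<Gamma>" and "\<And>x. f x \<le> A" and "\<And>x. f x = 0 \<or> g x = 0"
    and "sat cs f" and "sat cs g"
  shows "sat cs (\<lambda>x. f x + g x)"
  unfolding sat_def
proof
  fix c assume c: "c \<in> set cs"
  then have *: "weakly_separable_relation z (snd c)"
    using assms(1) weakly_separable by (auto simp: weakly_separable_def)
  show "map (\<lambda>x. val (f x + g x)) (fst c) \<in> tuples (snd c)"
    using c assms(4,5) *[unfolded weakly_separable_relation_def, rule_format,
        OF disjoint_val[of f g "fst c", OF assms(3)]]
    by (simp add: map2_val[of f g "fst c", OF assms(2,3)] sat_def)
qed

text \<open>Second clause of weak separability, with the tuples of \<open>f - g\<close> and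
  \<open>g\<close> as \<open>t\<^sub>1\<close> and \<open>t\<^sub>2\<close>. As \<open>g\<close> is
  below \<open>f\<close>, the truncated difference is \<open>f x\<close> where
  \<open>g x = 0\<close> and \<open>0\<close> elsewhere; so the tuples are disjoint and their union
  gives back \<open>f\<close>.\<close>

lemma sat_diff:
  assumes "snd ` set cs \<subseteq> \<Gamma>" and "\<And>x. f x \<le> A" and "g \<sqsubseteq> f"
    and "sat cs f" and "sat cs g"
  shows "sat cs (\<lambda>x. f x - g x)"
  unfolding sat_def
proof
  fix c assume c: "c \<in> set cs"
  then have *: "weakly_separable_relation z (snd c)"
    using assms(1) weakly_separable by (auto simp: weakly_separable_def)
  have le: "f x - g x \<le> A" for x using assms(2)[of x] by simp
  have disj: "f x - g x = 0 \<or> g x = 0" for x using assms(3) by (auto simp: below_def dest: spec[of _ x])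
  have "f x - g x + g x = f x" for x using assms(3) by (auto simp: below_def dest: spec[of _ x])
  then have "tuple_union z (map (\<lambda>x. val (f x - g x)) (fst c)) (map (\<lambda>x. val (g x)) (fst c)) =
      map (\<lambda>x. val (f x)) (fst c)"
    using map2_val[of "\<lambda>x. f x - g x" g, OF le disj] by simp
  moreover have "map (\<lambda>x. val (f x)) (fst c) \<in> tuples (snd c)"
    "map (\<lambda>x. val (g x)) (fst c) \<in> tuples (snd c)"
    using c assms(4,5) by (auto simp: sat_def)
  ultimately show "map (\<lambda>x. val (f x - g x)) (fst c) \<in> tuples (snd c)"
    using *[unfolded weakly_separable_relation_def, rule_format,
        OF disjoint_val[of "\<lambda>x. f x - g x" g "fst c", OF disj]]
    by simp
qed

text \<open>The start with one nonzero variable matters: if all constraints are 0-valid, a search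
  from the empty assignment would stop there at once. Fuel \<open>k\<close> below that variable is
  why leaves have up to \<open>Suc k\<close> variables. The list is descending because function 1 of
  the program builds it that way.\<close>

definition leaves :: "nat \<Rightarrow> (nat, 'd) constraint list \<Rightarrow> nat \<Rightarrow> assignment list" where
  "leaves n cs k = expand A (visits cs [] k) (rev [0..<n]) []"

definition family :: "nat \<Rightarrow> (nat, 'd) constraint list \<Rightarrow> nat \<Rightarrow> assignment list" where
  "family n cs k = fold (add_leaf k) (leaves n cs k) []"

definition kernel :: "nat \<Rightarrow> (nat, 'd) constraint list \<Rightarrow> nat \<Rightarrow> nat list" where
  "kernel n cs k = concat (map (map fst) (family n cs k))"

lemma set_kernel: "set (kernel n cs k) = (\<Union>g\<in>set (family n cs k). vars g)"
  by (simp add: kernel_def vars_def)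

lemma input_instance_scopes:
  "input_instance \<Gamma> (n, cs) \<Longrightarrow> c \<in> set cs \<Longrightarrow> set (fst c) \<subseteq> {..<n}"
  "input_instance \<Gamma> (n, cs) \<Longrightarrow> snd ` set cs \<subseteq> \<Gamma>"
  by (fastforce simp: input_instance_def csp_instance_def)+

lemma leaves_wf:
  assumes "input_instance \<Gamma> (n, cs)" and "g \<in> set (leaves n cs k)"
  shows "wf_assignment A n g" and "length g \<le> Suc k" and "vars g \<noteq> {}" and "sat cs (lookup g)"
proof -
  obtain x a where xa: "x < n" "a \<in> {1..A}" "g \<in> set (visits cs [] k [(x, a)])"
    using assms(2) by (auto simp: leaves_def set_expand)
  have "wf_assignment A n [(x, a)]"
    using xa by (auto simp: wf_assignment_def)
  then show "wf_assignment A n g" "length g \<le> Suc k"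
    using visits_wf[of cs n "[]" "[(x, a)]" g k] input_instance_scopes[OF assms(1)] xa by auto
  show "vars g \<noteq> {}"
    using vars_visits[OF xa(3)] by auto
  show "sat cs (lookup g)"
    using visits_sat[OF xa(3)] .
qed

text \<open>Solutions as total functions: being \<open>0\<close> from \<open>n\<close> on keeps the
  support finite, so the levels \<open>{x. f x = a}\<close> can be counted without mentioning
  \<open>n\<close>.\<close>

definition goal :: "nat \<Rightarrow> (nat, 'd) constraint list \<Rightarrow> (nat \<Rightarrow> nat) \<Rightarrow> bool" where
  "goal n cs f \<longleftrightarrow> sat cs f \<and> (\<forall>x. f x \<le> A) \<and> supp f \<subseteq> {..<n}"

text \<open>\<open>f'\<close> is \<open>f\<close> with a leaf \<open>l\<close> below
  \<open>q\<close> replaced by a leaf \<open>l'\<close> from the family. Nothing of the kernel is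
  lost, since \<open>l\<close> avoids it; something is gained, since \<open>l'\<close> is nonempty,
  lies inside the kernel and is disjoint from what remains of \<open>f\<close>.\<close>

lemma exchange:
  assumes inst: "input_instance \<Gamma> (n, cs)" and f: "goal n cs f" "card (supp f) \<le> k"
    and q: "sat cs q" "q \<sqsubseteq> f" "supp q \<noteq> {}" "supp q \<inter> set (kernel n cs k) = {}"
  shows "\<exists>f'. goal n cs f' \<and> (\<forall>a. a \<noteq> 0 \<longrightarrow> card {x. f' x = a} = card {x. f x = a}) \<and>
    card (supp f \<inter> set (kernel n cs k)) < card (supp f' \<inter> set (kernel n cs k))"
proof -
  note \<Gamma> = input_instance_scopes(2)[OF inst]
  let ?K = "set (kernel n cs k)" and ?F = "family n cs k"
  have fA: "f x \<le> A" for x using f by (simp add: goal_def)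
  have fin_f: "finite (supp f)"
    using f finite_subset by (auto simp: goal_def)
  have qf: "supp q \<subseteq> supp f" using q(2) by (auto simp: below_def) (metis gr0I)
  then have fin_q: "finite (supp q)" using fin_f finite_subset by blast
  have qA: "q x \<le> A" for x using q(2) fA[of x] by (auto simp: below_def dest: spec[of _ x])
  obtain x where x: "q x \<noteq> 0" using q(3) by auto
  then have "x < n" using qf f by (auto simp: goal_def)
  \<comment> \<open>The assignment to \<open>x\<close> already agrees with \<open>q\<close>, so all
    disagreements are among the at most \<open>k\<close> nonzero variables of
    \<open>f\<close>.\<close>
  have "card {y. lookup [(x, q x)] y \<noteq> q y} \<le> k"
    by (rule order_trans[OF card_mono[OF fin_f] f(2)]) (use qf in auto)
  moreover have "lookup [(x, q x)] \<sqsubseteq> q" by (auto simp: below_def)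
  ultimately obtain l where l: "l \<in> set (visits cs [] k [(x, q x)])" "lookup l \<sqsubseteq> q"
    using visits_reach[OF q(1) qA fin_q] by blast
  have leaf: "l \<in> set (leaves n cs k)"
    using l(1) x \<open>x < n\<close> qA[of x] by (fastforce simp: leaves_def set_expand)
  note l_wf = leaves_wf[OF inst leaf]
  have supp_l: "supp (lookup l) = vars l"
    using wf_lookup_eq_0[OF l_wf(1)] by auto
  have "vars l \<subseteq> supp q"
    using l(2) supp_l by (auto simp: below_def) (metis gr0I mem_Collect_eq)
  with q(4) have l_K: "vars l \<inter> ?K = {}" by auto
  \<comment> \<open>\<open>l\<close> avoids the kernel and hence meets no member of the family; the
    remaining alternative is that its type is full.\<close>
  have "k < length (filter (same_type l) ?F)"
    using fold_add_leaf_complete[OF leaf l_wf(3), of k "[]"] l_K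
    by (auto simp: set_kernel family_def)
  have l_f: "lookup l \<sqsubseteq> f" using l(2) q(2) by (rule below_trans)
  define r where "r = (\<lambda>x. f x - lookup l x)"
  have r_l: "r x = 0 \<or> lookup l x = 0" and r_add: "r x + lookup l x = f x" for x
    using l_f by (auto simp: r_def below_def dest: spec[of _ x])
  have r_f: "supp r \<subseteq> supp f" by (auto simp: r_def)
  then have fin_r: "finite (supp r)" using fin_f finite_subset by blast
  have "card (supp r) \<le> k"
    using card_mono[OF fin_f r_f] f(2) by simp
  have "sorted_wrt (\<lambda>f g. vars f \<inter> vars g = {}) ?F"
    unfolding family_def by (rule disjoint_fold_add_leaf) simp
  then obtain l' where l': "l' \<in> set ?F" "same_type l l'" "vars l' \<inter> supp r = {}"
    using disjoint_list_pigeonhole[OF sorted_wrt_filter fin_r, of ?F "same_type l"]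
      \<open>card (supp r) \<le> k\<close> \<open>k < length (filter (same_type l) ?F)\<close> by auto
  have "l' \<in> set (leaves n cs k)"
    using l'(1) set_fold_add_leaf[of k "leaves n cs k" "[]"] by (auto simp: family_def)
  note l'_wf = leaves_wf[OF inst this]
  have supp_l': "supp (lookup l') = vars l'"
    using wf_lookup_eq_0[OF l'_wf(1)] by auto
  have r_l': "r x = 0 \<or> lookup l' x = 0" for x
    using l'(3) supp_l' by auto
  define f' where "f' = (\<lambda>x. r x + lookup l' x)"
  have rA: "r x \<le> A" for x using fA[of x] by (simp add: r_def)
  have "sat cs r"
    unfolding r_def using \<Gamma> fA l_f f l_wf(4) by (intro sat_diff) (auto simp: goal_def)
  then have "sat cs f'"
    unfolding f'_def using \<Gamma> rA r_l' l'_wf(4) by (intro sat_add) auto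
  moreover have "f' x \<le> A" for x
    using r_l'[of x] rA[of x] wf_lookup_le[OF l'_wf(1), of x] by (auto simp: f'_def)
  moreover have supp_f': "supp f' = supp r \<union> vars l'"
    unfolding supp_l'[symmetric] by (auto simp: f'_def)
  then have "supp f' \<subseteq> {..<n}"
    using r_f f l'_wf(1) by (auto simp: goal_def wf_assignment_def)
  ultimately have "goal n cs f'" by (simp add: goal_def)
  moreover have "card {x. f' x = a} = card {x. f x = a}" if "a \<noteq> 0" for a
  proof -
    have "card {x. f' x = a} = card {x. r x = a} + card {x. lookup l' x = a}"
      unfolding f'_def using r_l' fin_r supp_l' that by (intro card_level_add) auto
    also have "\<dots> = card {x. r x = a} + card {x. lookup l x = a}"
      using card_lookup_level[OF l_wf(1) that] card_lookup_level[OF l'_wf(1) that] l'(2)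
      by (simp add: same_type_def)
    also have "\<dots> = card {x. r x + lookup l x = a}"
      using r_l fin_r supp_l that by (intro card_level_add[symmetric]) auto
    finally show ?thesis by (simp add: r_add)
  qed
  moreover have "supp f \<inter> ?K \<subset> supp f' \<inter> ?K"
  proof
    have "supp f \<subseteq> supp r \<union> vars l"
      unfolding supp_l[symmetric] by (auto simp: r_add[symmetric])
    then show "supp f \<inter> ?K \<subseteq> supp f' \<inter> ?K"
      using l_K supp_f' by auto
    obtain y where y: "y \<in> vars l'" using l'_wf(3) by auto
    then have "y \<in> ?K" using l'(1) by (auto simp: set_kernel)
    moreover have "y \<notin> supp f"
      using y l'(3) \<open>y \<in> ?K\<close> l_K \<open>supp f \<subseteq> supp r \<union> vars l\<close> by auto
    ultimately have "y \<in> supp f' \<inter> ?K" "y \<notin> supp f \<inter> ?K"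
      using y supp_f' by auto
    then show "supp f \<inter> ?K \<noteq> supp f' \<inter> ?K" by (metis (no_types))
  qed
  then have "card (supp f \<inter> ?K) < card (supp f' \<inter> ?K)"
    by (intro psubset_card_mono) auto
  ultimately show ?thesis by blast
qed

lemma kernel_subset:
  assumes "input_instance \<Gamma> (n, cs)"
  shows "set (kernel n cs k) \<subseteq> {..<n}"
proof -
  have "vars l \<subseteq> {..<n}" if "l \<in> set (family n cs k)" for l
    using that leaves_wf(1)[OF assms, of l k] set_fold_add_leaf[of k "leaves n cs k" "[]"]
    by (auto simp: family_def wf_assignment_def)
  then show ?thesis by (auto simp: set_kernel)
qed

text \<open>The conclusion compares value counts only, because the search is shown to reach an
  optimal \<open>f'\<close> with the same counts rather than \<open>f\<close> itself.\<close>

lemma search_complete: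
  assumes inst: "input_instance \<Gamma> (n, cs)" and f: "goal n cs f" "card (supp f) \<le> k"
  shows "\<exists>g\<in>set (visits cs (kernel n cs k) k []).
    \<forall>a. a \<noteq> 0 \<longrightarrow> count_list (map snd g) a = card {x. f x = a}"
proof -
  let ?W = "kernel n cs k"
  let ?P = "\<lambda>f'. goal n cs f' \<and> (\<forall>a. a \<noteq> 0 \<longrightarrow> card {x. f' x = a} = card {x. f x = a})"
  let ?m = "\<lambda>f'. card (supp f' \<inter> set ?W)"
  have "\<exists>f'. ?P f' \<and> (\<forall>f''. ?P f'' \<longrightarrow> ?m f'' \<le> ?m f')"
  proof (rule ex_has_greatest_nat[of ?P f ?m "Suc (card (set ?W))"])
    show "\<forall>f'. ?P f' \<longrightarrow> ?m f' < Suc (card (set ?W))"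
      by (auto simp: less_Suc_eq_le intro!: card_mono)
  qed (use f in auto)
  then obtain f' where f': "?P f'" and max: "\<And>f''. ?P f'' \<Longrightarrow> ?m f'' \<le> ?m f'" by blast
  have f'A: "f' x \<le> A" for x using f' by (simp add: goal_def)
  have fin: "finite (supp f'')" if "goal n cs f''" for f''
    using that finite_subset by (auto simp: goal_def)
  \<comment> \<open>Equal counts at all nonzero levels give equal support sizes, so fuel
    \<open>k\<close> suffices for \<open>f'\<close> as well.\<close>
  have "card (supp f') = card (supp f)"
    using card_supp_levels[of f' A] card_supp_levels[of f A] f' f(1) fin by (auto simp: goal_def)
  with f(2) have card: "card (supp f') \<le> k" by simp
  have "card {x. lookup [] x \<noteq> f' x} \<le> k"
    using card by (auto simp: eq_commute[of 0])
  then obtain g where g: "g \<in> set (visits cs ?W k [])" "lookup g \<sqsubseteq> f'"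
      "\<forall>w\<in>set ?W. lookup g w = f' w"
    using visits_reach[of cs f' "[]" k ?W] f' f'A fin by (auto simp: goal_def below_def)
  have sat_g: "sat cs (lookup g)" using visits_sat[OF g(1)] .
  have g_wf: "wf_assignment A n g"
    using visits_wf[of cs n ?W "[]" g k] input_instance_scopes(1)[OF inst]
      kernel_subset[OF inst] g(1) by auto
  have "lookup g = f'"
  proof (rule ccontr)
    assume "lookup g \<noteq> f'"
    \<comment> \<open>\<open>q\<close> is what the search has missed of \<open>f'\<close>. It is
      satisfying by \<open>sat_diff\<close> and avoids the kernel because \<open>g\<close> agrees
      with \<open>f'\<close> there, so \<open>exchange\<close> would improve the optimum.\<close>
    define q where "q = (\<lambda>x. f' x - lookup g x)"
    have "sat cs q"
      unfolding q_def using input_instance_scopes(2)[OF inst] f'A g(2) f' sat_g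
      by (intro sat_diff) (auto simp: goal_def)
    moreover have "q \<sqsubseteq> f'"
      using g(2) unfolding q_def below_def by (metis diff_self_eq_0 minus_nat.diff_0)
    moreover have "supp q \<noteq> {}"
    proof -
      obtain x where "lookup g x \<noteq> f' x" using \<open>lookup g \<noteq> f'\<close> by auto
      moreover have "lookup g x = 0 \<or> lookup g x = f' x" using g(2) by (auto simp: below_def)
      ultimately have "x \<in> supp q" by (auto simp: q_def)
      then show ?thesis by blast
    qed
    moreover have "supp q \<inter> set ?W = {}"
      using g(3) by (auto simp: q_def)
    ultimately obtain f'' where "goal n cs f''"
        "\<forall>a. a \<noteq> 0 \<longrightarrow> card {x. f'' x = a} = card {x. f' x = a}" "?m f' < ?m f''"
      using exchange[OF inst _ card] f' by metis
    then show False
      using max[of f''] f' by auto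
  qed
  then show ?thesis
    using g(1) f' card_lookup_level[OF g_wf] by metis
qed

lemma search_sound:
  assumes "input_instance \<Gamma> (n, cs)" and "g \<in> set (visits cs (kernel n cs k) k [])"
  shows "wf_assignment A n g" and "goal n cs (lookup g)"
proof -
  show wf: "wf_assignment A n g"
    using visits_wf[of cs n "kernel n cs k" "[]" g k] input_instance_scopes(1)[OF assms(1)]
      kernel_subset[OF assms(1)] assms(2) by auto
  have "supp (lookup g) \<subseteq> vars g"
    using wf_lookup_eq_0[OF wf] by auto
  moreover have "vars g \<subseteq> {..<n}"
    using wf by (simp add: wf_assignment_def)
  ultimately show "goal n cs (lookup g)"
    using visits_sat[OF assms(2)] wf_lookup_le[OF wf] by (auto simp: goal_def)
qed

lemma wf_card_supp:
  assumes "wf_assignment A n g"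
  shows "card (supp (lookup g)) = length g"
proof -
  have "supp (lookup g) = set (map fst g)"
    using wf_lookup_eq_0[OF assms] by (auto simp: vars_def)
  then show ?thesis
    using assms distinct_card[of "map fst g"] by (simp add: wf_assignment_def)
qed

section \<open>Translation between codes and values\<close>

lemma goal_satisfying:
  assumes "input_instance \<Gamma> (n, cs)" and "goal n cs f"
  shows "satisfying D {..<n} (set cs) (\<lambda>x. val (f x))"
  using assms range_val by (fastforce simp: satisfying_def goal_def sat_def)

lemma satisfying_goal:
  assumes inst: "input_instance \<Gamma> (n, cs)" and \<tau>: "satisfying D {..<n} (set cs) \<tau>"
  obtains f where "goal n cs f" and "\<And>x. x < n \<Longrightarrow> val (f x) = \<tau> x"
proof -
  \<comment> \<open>The code is pinned to \<open>0\<close> outside the variables, where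
    \<open>\<tau>\<close> says nothing; this bounds the support of \<open>f\<close>.\<close>
  have "\<exists>i. i \<le> A \<and> (if x < n then val i = \<tau> x else i = 0)" for x
  proof (cases "x < n")
    case True
    then have "\<tau> x \<in> val ` {..A}"
      using \<tau> by (auto simp: satisfying_def range_val)
    then show ?thesis using True by auto
  qed auto
  then obtain f where f: "\<And>x. f x \<le> A" "\<And>x. if x < n then val (f x) = \<tau> x else f x = 0"
    by metis
  then have f_\<tau>: "val (f x) = \<tau> x" if "x < n" for x
    using that by (metis (full_types))
  have "sat cs f"
    unfolding sat_def
  proof
    fix c assume c: "c \<in> set cs"
    then have eq: "map (\<lambda>x. val (f x)) (fst c) = map \<tau> (fst c)"
      using input_instance_scopes(1)[OF inst c] f_\<tau> by auto
    show "map (\<lambda>x. val (f x)) (fst c) \<in> tuples (snd c)"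
      unfolding eq using \<tau> c by (auto simp: satisfying_def)
  qed
  moreover have "supp f \<subseteq> {..<n}"
    using f(2) by (metis (mono_tags, lifting) lessThan_iff mem_Collect_eq subsetI)
  ultimately have "goal n cs f" using f(1) by (simp add: goal_def)
  then show thesis using f_\<tau> that by blast
qed

lemma goal_level:
  assumes "goal n cs f" and "\<And>x. x < n \<Longrightarrow> val (f x) = \<tau> x" and "i \<in> {1..A}"
  shows "{v \<in> {..<n}. \<tau> v = val i} = {x. f x = i}"
proof -
  have "x < n \<and> \<tau> x = val i \<longleftrightarrow> f x = i" for x
  proof (cases "x < n")
    case True
    then show ?thesis using assms val_inj[of "f x" i] by (auto simp: goal_def)
  next
    case False
    then have "f x = 0" using assms(1) by (auto simp: goal_def)
    then show ?thesis using False assms(3) by auto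
  qed
  then show ?thesis by auto
qed

lemma goal_size:
  assumes "goal n cs f" and "\<And>x. x < n \<Longrightarrow> val (f x) = \<tau> x"
  shows "assignment_size z {..<n} \<tau> = card (supp f)"
proof -
  have "x < n \<and> \<tau> x \<noteq> z \<longleftrightarrow> f x \<noteq> 0" for x
  proof (cases "x < n")
    case True
    then show ?thesis using assms val_eq_z[of "f x"] by (auto simp: goal_def)
  next
    case False
    then show ?thesis using assms(1) by (auto simp: goal_def)
  qed
  then have "{v \<in> {..<n}. \<tau> v \<noteq> z} = supp f" by auto
  then show ?thesis by (simp add: assignment_size_def)
qed

lemma goal_card_supp: "goal n cs f \<Longrightarrow> card (supp f) = (\<Sum>i\<in>{1..A}. card {x. f x = i})"
  using finite_subset[of "supp f" "{..<n}"] by (intro card_supp_levels) (auto simp: goal_def)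

section \<open>Correctness of the search for both problems\<close>

lemma ocsp_search:
  assumes inst: "input_instance \<Gamma> (n, cs)"
  shows "(\<exists>g\<in>set (visits cs (kernel n cs k) k []). length g = k) \<longleftrightarrow>
    ocsp_solvable D z {..<n} (set cs) k"
proof
  assume "\<exists>g\<in>set (visits cs (kernel n cs k) k []). length g = k"
  then obtain g where g: "g \<in> set (visits cs (kernel n cs k) k [])" "length g = k" by auto
  note sound = search_sound[OF inst g(1)]
  show "ocsp_solvable D z {..<n} (set cs) k"
    unfolding ocsp_solvable_def
    using goal_satisfying[OF inst sound(2)] goal_size[OF sound(2) refl] wf_card_supp[OF sound(1)] g(2)
    by (intro exI[of _ "\<lambda>x. val (lookup g x)"]) simp
next
  assume "ocsp_solvable D z {..<n} (set cs) k"
  then obtain \<tau> where \<tau>: "satisfying D {..<n} (set cs) \<tau>" "assignment_size z {..<n} \<tau> = k"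
    by (auto simp: ocsp_solvable_def)
  obtain f where f: "goal n cs f" "\<And>x. x < n \<Longrightarrow> val (f x) = \<tau> x"
    using satisfying_goal[OF inst \<tau>(1)] by blast
  have card: "card (supp f) = k" using goal_size[OF f] \<tau>(2) by simp
  obtain g where g: "g \<in> set (visits cs (kernel n cs k) k [])"
      "\<And>a. a \<noteq> 0 \<Longrightarrow> count_list (map snd g) a = card {x. f x = a}"
    using search_complete[OF inst f(1)] card by auto
  note sound = search_sound[OF inst g(1)]
  have "length g = (\<Sum>i\<in>{1..A}. card {x. lookup g x = i})"
    using wf_card_supp[OF sound(1)] goal_card_supp[OF sound(2)] by simp
  also have "\<dots> = (\<Sum>i\<in>{1..A}. card {x. f x = i})"
    using g(2) card_lookup_level[OF sound(1)] by (intro sum.cong) auto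
  also have "\<dots> = k" using goal_card_supp[OF f(1)] card by simp
  finally show "\<exists>g\<in>set (visits cs (kernel n cs k) k []). length g = k"
    using g(1) by blast
qed

text \<open>The assumption on \<open>k\<close> gives every solution exactly \<open>k\<close> nonzero
  variables, which is the fuel of the search.\<close>

lemma ccsp_search:
  assumes inst: "input_instance \<Gamma> (n, cs)" and k: "k = (\<Sum>a\<in>D - {z}. \<pi> a)"
  shows "(\<exists>g\<in>set (visits cs (kernel n cs k) k []). \<forall>j<A. count_list (map snd g) (Suc j) = \<pi> (vals ! j))
    \<longleftrightarrow> ccsp_solvable D z {..<n} (set cs) \<pi>"
proof
  assume "\<exists>g\<in>set (visits cs (kernel n cs k) k []). \<forall>j<A. count_list (map snd g) (Suc j) = \<pi> (vals ! j)"
  then obtain g where g: "g \<in> set (visits cs (kernel n cs k) k [])"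
    "\<forall>j<A. count_list (map snd g) (Suc j) = \<pi> (vals ! j)" by blast
  note sound = search_sound[OF inst g(1)]
  let ?\<tau> = "\<lambda>x. val (lookup g x)"
  have "card {v \<in> {..<n}. ?\<tau> v = a} = \<pi> a" if a: "a \<in> D - {z}" for a
  proof -
    obtain j where j: "j < A" "a = vals ! j"
      using a unfolding set_vals[symmetric] in_set_conv_nth by blast
    have "{v \<in> {..<n}. ?\<tau> v = a} = {x. lookup g x = Suc j}"
      using goal_level[OF sound(2) refl, of "Suc j"] j by simp
    then show ?thesis
      using card_lookup_level[OF sound(1), of "Suc j"] g(2) j by simp
  qed
  then show "ccsp_solvable D z {..<n} (set cs) \<pi>"
    unfolding ccsp_solvable_def using goal_satisfying[OF inst sound(2)] by blast
next
  assume "ccsp_solvable D z {..<n} (set cs) \<pi>"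
  then obtain \<tau> where \<tau>: "satisfying D {..<n} (set cs) \<tau>"
      "\<And>a. a \<in> D - {z} \<Longrightarrow> card {v \<in> {..<n}. \<tau> v = a} = \<pi> a"
    by (auto simp: ccsp_solvable_def)
  obtain f where f: "goal n cs f" "\<And>x. x < n \<Longrightarrow> val (f x) = \<tau> x"
    using satisfying_goal[OF inst \<tau>(1)] by blast
  have level: "card {x. f x = Suc j} = \<pi> (vals ! j)" if "j < A" for j
    using goal_level[OF f, of "Suc j"] \<tau>(2)[of "vals ! j"] that set_vals nth_mem[OF that] by auto
  have "card (supp f) = (\<Sum>j<A. card {x. f x = Suc j})"
    unfolding goal_card_supp[OF f(1)] by (rule sum.reindex_bij_witness[of _ Suc "\<lambda>i. i - 1"]) auto
  also have "\<dots> = (\<Sum>j<A. \<pi> (vals ! j))"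
    using level by simp
  also have "\<dots> = sum_list (map \<pi> vals)"
    by (simp add: sum_list_sum_nth atLeast0LessThan)
  also have "\<dots> = k"
    using distinct_vals set_vals k by (simp add: sum_list_distinct_conv_sum_set)
  finally have "card (supp f) \<le> k" by (rule eq_imp_le)
  then obtain g where g: "g \<in> set (visits cs (kernel n cs k) k [])"
      "\<forall>a. a \<noteq> 0 \<longrightarrow> count_list (map snd g) a = card {x. f x = a}"
    using search_complete[OF inst f(1)] by blast
  have "count_list (map snd g) (Suc j) = \<pi> (vals ! j)" if "j < A" for j
    using g(2) level[OF that] by simp
  then show "\<exists>g\<in>set (visits cs (kernel n cs k) k []). \<forall>j<A. count_list (map snd g) (Suc j) = \<pi> (vals ! j)"
    using g(1) by blast
qed

end


section \<open>The program\<close>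

definition enc_assignment :: "assignment \<Rightarrow> tree" where
  "enc_assignment = enc_list (\<lambda>(x, a). Node (enc_nat x) (enc_nat a))"

lemma enc_assignment_simps [simp]:
  "enc_assignment [] = Leaf"
  "enc_assignment ((x, a) # h) = Node (Node (enc_nat x) (enc_nat a)) (enc_assignment h)"
  by (simp_all add: enc_assignment_def)

text \<open>The membership test of a relation, as a decision tree over the coordinates.\<close>

primrec trie :: "nat \<Rightarrow> nat \<Rightarrow> (nat list \<Rightarrow> bool) \<Rightarrow> tree" where
  "trie A 0 p = enc_bool (p [])"
| "trie A (Suc m) p = enc_list (\<lambda>t. t) (map (\<lambda>i. trie A m (\<lambda>t. p (i # t))) [0..<Suc A])"

text \<open>
  The functions of the program by number: 1 list of the variables, 2 list access, 3 equality of
  numbers, 4 \<open>lookup\<close>, 5 evaluation of a \<open>trie\<close>, 6 \<open>violated\<close>, 7 intersection of \<open>vars\<close>,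
  8 \<open>same_type\<close>, 9 the condition of \<open>add_leaf\<close>, 10 list of the variables of a family, 11 processing
  of a visited assignment, 12 to 14 the search, 15 the final test, 16 \<open>count_list\<close>, 17 comparison of
  all counts. The last argument of 11 to 14 selects the phase.
\<close>

definition solver_prog :: "tree \<Rightarrow> tree \<Rightarrow> expr \<Rightarrow> expr \<Rightarrow> prog" where
  "solver_prog tab vs ke fe =
   [Call 12 [Quote Leaf, ke, Quote Leaf,
      Call 10 [Quote Leaf, Call 13 [Call 1 [LeftOf (LeftOf (Var 0))], Quote Leaf, ke, Quote Leaf,
        Quote Leaf, RightOf (LeftOf (Var 0)), MkNode (Quote Leaf) ke]],
      RightOf (LeftOf (Var 0)), MkNode (Quote (Node Leaf Leaf)) (RightOf (Var 0))],
    IfNode (Var 0) (MkNode (RightOf (Var 0)) (Call 1 [RightOf (Var 0)])) (Quote Leaf),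
    IfNode (Var 1) (Call 2 [RightOf (Var 0), RightOf (Var 1)]) (LeftOf (Var 0)),
    IfNode (Var 0) (IfNode (Var 1) (Call 3 [RightOf (Var 0), RightOf (Var 1)]) (Quote Leaf))
      (IfNode (Var 1) (Quote Leaf) (Quote (Node Leaf Leaf))),
    IfNode (Var 0) (IfNode (Call 3 [LeftOf (LeftOf (Var 0)), Var 1]) (RightOf (LeftOf (Var 0)))
      (Call 4 [RightOf (Var 0), Var 1])) (Quote Leaf),
    IfNode (Var 1) (Call 5 [Call 2 [Var 0, Call 4 [Var 2, LeftOf (Var 1)]], RightOf (Var 1), Var 2])
      (Var 0),
    IfNode (Var 0)
      (IfNode (Call 5 [Call 2 [Quote tab, LeftOf (LeftOf (Var 0))], RightOf (LeftOf (Var 0)), Var 1])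
        (Call 6 [RightOf (Var 0), Var 1]) (LeftOf (Var 0)))
      (Quote Leaf),
    IfNode (Var 0) (IfNode (Call 4 [Var 1, LeftOf (LeftOf (Var 0))]) (Quote (Node Leaf Leaf))
      (Call 7 [RightOf (Var 0), Var 1])) (Quote Leaf),
    IfNode (Var 0)
      (IfNode (Var 1)
        (IfNode (Call 3 [RightOf (LeftOf (Var 0)), RightOf (LeftOf (Var 1))])
          (Call 8 [RightOf (Var 0), RightOf (Var 1)]) (Quote Leaf))
        (Quote Leaf))
      (IfNode (Var 1) (Quote Leaf) (Quote (Node Leaf Leaf))),
    IfNode (Var 1)
      (IfNode (Call 7 [Var 0, LeftOf (Var 1)]) (Quote Leaf)
        (IfNode (Call 8 [Var 0, LeftOf (Var 1)])
          (IfNode (Var 2) (Call 9 [Var 0, RightOf (Var 1), RightOf (Var 2)]) (Quote Leaf))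
          (Call 9 [Var 0, RightOf (Var 1), Var 2])))
      (Quote (Node Leaf Leaf)),
    IfNode (Var 0) (MkNode (LeftOf (LeftOf (Var 0))) (Call 10 [RightOf (Var 0), Var 1]))
      (IfNode (Var 1) (Call 10 [LeftOf (Var 1), RightOf (Var 1)]) (Quote Leaf)),
    IfNode (LeftOf (Var 2))
      (IfNode (Var 1) (Var 1) (Call 15 [Var 0, RightOf (Var 2)]))
      (IfNode (Call 9 [Var 0, Var 1, RightOf (Var 2)]) (MkNode (Var 0) (Var 1)) (Var 1)),
    LetIn (Call 6 [Var 4, Var 0])
      (IfNode (Var 0)
        (IfNode (Var 2)
          (Call 13 [RightOf (Var 0), Var 1, RightOf (Var 2), Var 3, Var 4, Var 5, Var 6])
          (Var 3))
        (IfNode (Var 2)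
          (Call 13 [Var 4, Var 1, RightOf (Var 2), Call 11 [Var 1, Var 3, Var 6], Var 4, Var 5, Var 6])
          (Call 11 [Var 1, Var 3, Var 6]))),
    IfNode (Var 0)
      (Call 13 [RightOf (Var 0), Var 1, Var 2,
        IfNode (Call 4 [Var 1, LeftOf (Var 0)]) (Var 3)
          (Call 14 [Quote vs, LeftOf (Var 0), Var 1, Var 2, Var 3, Var 4, Var 5, Var 6]),
        Var 4, Var 5, Var 6])
      (Var 3),
    IfNode (Var 0)
      (Call 14 [RightOf (Var 0), Var 1, Var 2, Var 3,
        Call 12 [MkNode (MkNode (Var 1) (LeftOf (Var 0))) (Var 2), Var 3, Var 4, Var 5, Var 6, Var 7],
        Var 5, Var 6, Var 7])
      (Var 4),
    fe,
    IfNode (Var 0)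
      (IfNode (Call 3 [RightOf (LeftOf (Var 0)), Var 1])
        (MkNode (Quote Leaf) (Call 16 [RightOf (Var 0), Var 1]))
        (Call 16 [RightOf (Var 0), Var 1]))
      (Quote Leaf),
    IfNode (Var 2)
      (IfNode (Call 3 [Call 16 [Var 0, Var 1], LeftOf (Var 2)])
        (Call 17 [Var 0, MkNode (Quote Leaf) (Var 1), RightOf (Var 2)]) (Quote Leaf))
      (Quote (Node Leaf Leaf))]"

text \<open>The two problems differ in two expressions only: \<open>ke\<close> reads
  \<open>k\<close> off the input, and \<open>fe\<close> is the body of the final test, function
  15.\<close>

locale solver = weak_language D z \<Gamma> vals
  for D :: "'d set" and z :: 'd and \<Gamma> :: "'d relation set" and vals :: "'d list" +
  fixes \<rho> :: "'d relation \<Rightarrow> nat" and ke fe :: expr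
  assumes finite_\<Gamma>: "finite \<Gamma>" and inj_\<rho>: "inj_on \<rho> \<Gamma>"
begin

text \<open>The language is fixed, so the membership tests of its relations are a constant of the
  program. Entries at indices that are not the number of a relation are arbitrary and never looked
  up on a valid input; \<open>insert 0\<close> covers the empty language.\<close>

definition table :: "tree list" where
  "table = map (\<lambda>i. let R = inv_into \<Gamma> \<rho> i in trie A (arity R) (\<lambda>t. map val t \<in> tuples R))
    [0..<Suc (Max (insert 0 (\<rho> ` \<Gamma>)))]"

definition P :: prog where
  "P = solver_prog (enc_list (\<lambda>t. t) table) (enc_list enc_nat [1..<Suc A]) ke fe"

lemma length_P [simp]: "length P = 18"
  by (simp add: P_def solver_prog_def)

lemmas body = P_def[THEN arg_cong[where f = "\<lambda>p. p ! i" for i], unfolded solver_prog_def]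

lemma table:
  assumes "R \<in> \<Gamma>"
  shows "\<rho> R < length table" and "table ! \<rho> R = trie A (arity R) (\<lambda>t. map val t \<in> tuples R)"
proof -
  have "\<rho> R \<le> Max (insert 0 (\<rho> ` \<Gamma>))"
    using assms finite_\<Gamma> by (intro Max_ge) auto
  then show *: "\<rho> R < length table" by (simp add: table_def)
  have "inv_into \<Gamma> \<rho> (\<rho> R) = R" using assms inj_\<rho> by simp
  then show "table ! \<rho> R = trie A (arity R) (\<lambda>t. map val t \<in> tuples R)"
    using * by (simp add: table_def Let_def del: upt_Suc)
qed

section \<open>Cost of the elementary functions\<close>

lemma run_vars: "calls_in P 1 [enc_nat n] (enc_list enc_nat (rev [0..<n])) (10 * Suc n)"
proof (induction n)
  case 0
  show ?case by (rule calls_inI[OF _ body]) (simp_all add: run_simps)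
next
  case (Suc n)
  obtain t where t: "t \<le> 10 * Suc n" and
    "\<And>v' t'. call P 1 [enc_nat n] v' t' \<longleftrightarrow> v' = enc_list enc_nat (rev [0..<n]) \<and> t' = t"
    using calls_inE[OF Suc] by blast
  then show ?case by (intro calls_inI[OF _ body]) (simp_all add: run_simps)
qed

lemma run_nth: "i < length ts \<Longrightarrow> calls_in P 2 [enc_list (\<lambda>t. t) ts, enc_nat i] (ts ! i) (8 * Suc i)"
proof (induction i arbitrary: ts)
  case 0
  then obtain t ts' where "ts = t # ts'" by (cases ts) auto
  then show ?case by (intro calls_inI[OF _ body]) (simp_all add: run_simps)
next
  case (Suc i)
  then obtain t ts' where ts: "ts = t # ts'" "i < length ts'" by (cases ts) auto
  obtain t where "t \<le> 8 * Suc i" and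
    "\<And>v' t'. call P 2 [enc_list (\<lambda>t. t) ts', enc_nat i] v' t' \<longleftrightarrow> v' = ts' ! i \<and> t' = t"
    using calls_inE[OF Suc.IH[OF ts(2)]] by blast
  then show ?case using ts by (intro calls_inI[OF _ body]) (simp_all add: run_simps)
qed

text \<open>Both right spines are walked in parallel, so the first argument alone controls the cost;
  callers put a quantity with a known bound there.\<close>

lemma run_eq: "calls_in P 3 [x, y] (enc_bool (rdepth x = rdepth y)) (12 * Suc (rdepth x))"
proof (induction x arbitrary: y)
  case Leaf
  show ?case by (cases y) (intro calls_inI[OF _ body]; simp add: run_simps)+
next
  case (Node l r)
  show ?case
  proof (cases y)
    case Leaf
    then show ?thesis by (intro calls_inI[OF _ body]) (simp_all add: run_simps)
  next
    case (Node l' r')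
    obtain t where "t \<le> 12 * Suc (rdepth r)" and
      "\<And>v' t'. call P 3 [r, r'] v' t' \<longleftrightarrow> v' = enc_bool (rdepth r = rdepth r') \<and> t' = t"
      using calls_inE[OF Node.IH(2)] by blast
    then show ?thesis using Node by (intro calls_inI[OF _ body]) (simp_all add: run_simps)
  qed
qed


end


section \<open>Running times\<close>

text \<open>\<open>L\<close> is a common upper bound for the relevant numbers and list lengths, so
  that costs become constants times powers of \<open>L\<close>. It is left free and fixed only in
  the final estimate.\<close>

locale solver_run = solver D z \<Gamma> vals \<rho> ke fe
  for D :: "'d set" and z :: 'd and \<Gamma> :: "'d relation set" and vals :: "'d list"
    and \<rho> :: "'d relation \<Rightarrow> nat" and ke fe :: expr +
  fixes n :: nat and cs :: "(nat, 'd) constraint list" and k L :: nat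
  assumes inst: "input_instance \<Gamma> (n, cs)"
    and L_pos: "1 \<le> L" and n_le: "n \<le> L" and A_le: "A \<le> L" and cs_le: "length cs \<le> L"
    and k_le: "Suc k \<le> L" and \<rho>_le: "\<And>R. R \<in> \<Gamma> \<Longrightarrow> \<rho> R \<le> L"
    and arity_le: "\<And>R. R \<in> \<Gamma> \<Longrightarrow> arity R \<le> L"
begin

definition ok :: "assignment \<Rightarrow> bool" where
  "ok h \<longleftrightarrow> wf_assignment A n h \<and> length h \<le> Suc k"

lemma L_powers: "L \<le> L ^ 2" "L ^ 2 \<le> L ^ 3" "L ^ 3 \<le> L ^ 4" "1 \<le> L ^ 2" "1 \<le> L ^ 3" "1 \<le> L ^ 4"
  using L_pos by (auto simp: power_increasing self_le_power)

lemma L_pow4: "L ^ 4 = L ^ 3 * L"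
  by (simp add: eval_nat_numeral)

text \<open>Inductions over a list give costs \<open>c * Suc (length xs)\<close>; this rounds them
  to powers of \<open>L\<close>. The factor 2 is why constants double, as from 50 to 100 or from 450
  to 900.\<close>

lemma mult_Suc_le: "m \<le> L \<Longrightarrow> c * Suc m \<le> 2 * (c * L)"
  using L_pos mult_le_mono2[of "Suc m" "2 * L" c] by (simp add: ac_simps)

lemma run_eq_nat:
  assumes "x \<le> L"
  shows "calls_in P 3 [enc_nat x, y] (enc_bool (x = rdepth y)) (24 * L)"
  using calls_in_mono[OF run_eq[of "enc_nat x" y]] assms L_pos by simp

lemma run_lookup:
  assumes "ok h"
  shows "calls_in P 4 [enc_assignment h, enc_nat x] (enc_nat (lookup h x)) (100 * L ^ 2)"
proof -
  have "calls_in P 4 [enc_assignment h, enc_nat x] (enc_nat (lookup h x)) (50 * L * Suc (length h))"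
    if "wf_assignment A n h" for h
    using that
  proof (induction h)
    case Nil
    show ?case using L_pos by (intro calls_inI[OF _ body]) (simp_all add: run_simps)
  next
    case (Cons p h)
    obtain y a where p: "p = (y, a)" by fastforce
    have wf: "wf_assignment A n h" "y \<le> L" "a \<noteq> 0"
      using Cons.prems n_le by (auto simp: p wf_assignment_def)
    obtain t\<^sub>1 where "t\<^sub>1 \<le> 24 * L" and
      "\<And>v' t'. call P 3 [enc_nat y, enc_nat x] v' t' \<longleftrightarrow> v' = enc_bool (y = x) \<and> t' = t\<^sub>1"
      using calls_inE[OF run_eq_nat[OF wf(2), of "enc_nat x"]] by auto
    moreover obtain t\<^sub>2 where "t\<^sub>2 \<le> 50 * L * Suc (length h)" and
      "\<And>v' t'. call P 4 [enc_assignment h, enc_nat x] v' t' \<longleftrightarrow> v' = enc_nat (lookup h x) \<and> t' = t\<^sub>2"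
      using calls_inE[OF Cons.IH[OF wf(1)]] by blast
    ultimately show ?case
      using L_pos by (intro calls_inI[OF _ body]) (auto simp: p run_simps algebra_simps)
  qed
  moreover have "50 * L * Suc (length h) \<le> 100 * L ^ 2"
    using mult_Suc_le[of "length h" "50 * L"] assms k_le by (simp add: ok_def power2_eq_square)
  ultimately show ?thesis
    using assms by (auto simp: ok_def intro: calls_in_mono)
qed

text \<open>\<open>p\<close> has to vary in the induction, since the subtrie for a first value
  \<open>i\<close> tests \<open>p (i # t)\<close>. Each coordinate costs one \<open>lookup\<close>
  and one list access.\<close>

lemma run_trie:
  assumes "ok h" and "length s \<le> L"
  shows "calls_in P 5 [trie A (length s) p, enc_list enc_nat s, enc_assignment h]
    (enc_bool (p (map (lookup h) s))) (300 * L ^ 3)"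
proof -
  have "calls_in P 5 [trie A (length s) p, enc_list enc_nat s, enc_assignment h]
    (enc_bool (p (map (lookup h) s))) (150 * L ^ 2 * Suc (length s))" for s
  proof (induction s arbitrary: p)
    case Nil
    show ?case using L_powers by (intro calls_inI[OF _ body]) (simp_all add: run_simps)
  next
    case (Cons x s)
    let ?i = "lookup h x"
    have i: "?i \<le> A" using assms(1) wf_lookup_le by (auto simp: ok_def)
    define ts where "ts = map (\<lambda>i. trie A (length s) (\<lambda>t. p (i # t))) [0..<Suc A]"
    have ts: "?i < length ts" "ts ! ?i = trie A (length s) (\<lambda>t. p (?i # t))"
      using i by (auto simp: ts_def simp del: upt_Suc)
    obtain t\<^sub>1 where "t\<^sub>1 \<le> 100 * L ^ 2" and
      "\<And>v' t'. call P 4 [enc_assignment h, enc_nat x] v' t' \<longleftrightarrow> v' = enc_nat ?i \<and> t' = t\<^sub>1"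
      using calls_inE[OF run_lookup[OF assms(1)]] by blast
    moreover obtain t\<^sub>2 where "t\<^sub>2 \<le> 8 * Suc ?i" and
      "\<And>v' t'. call P 2 [enc_list (\<lambda>t. t) ts, enc_nat ?i] v' t' \<longleftrightarrow> v' = ts ! ?i \<and> t' = t\<^sub>2"
      using calls_inE[OF run_nth[OF ts(1)]] by blast
    moreover obtain t\<^sub>3 where "t\<^sub>3 \<le> 150 * L ^ 2 * Suc (length s)" and
      "\<And>v' t'. call P 5 [trie A (length s) (\<lambda>t. p (?i # t)), enc_list enc_nat s, enc_assignment h] v' t'
        \<longleftrightarrow> v' = enc_bool (p (?i # map (lookup h) s)) \<and> t' = t\<^sub>3"
      using calls_inE[OF Cons.IH] by blast
    moreover have "trie A (length (x # s)) p = enc_list (\<lambda>t. t) ts"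
      by (simp add: ts_def)
    ultimately show ?case
      using i A_le L_powers L_pos
      by (intro calls_inI[OF _ body]) (simp_all add: run_simps ts algebra_simps del: trie.simps)
  qed
  moreover have "150 * L ^ 2 * Suc (length s) \<le> 300 * L ^ 3"
    using mult_Suc_le[of "length s" "150 * L ^ 2"] assms(2) by (simp add: power2_eq_square power3_eq_cube)
  ultimately show ?thesis
    using assms by (auto intro: calls_in_mono)
qed

lemma constraintD:
  assumes "c \<in> set cs"
  shows "snd c \<in> \<Gamma>" and "length (fst c) = arity (snd c)" and "set (fst c) \<subseteq> {..<n}"
  using inst assms by (fastforce simp: input_instance_def csp_instance_def)+

text \<open>An encoded constraint is always a \<open>Node\<close>, so a single \<open>IfNode\<close>
  tells the two cases apart.\<close>

definition enc_violated :: "(nat, 'd) constraint option \<Rightarrow> tree" where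
  "enc_violated v = (case v of None \<Rightarrow> Leaf | Some c \<Rightarrow> enc_constraint \<rho> c)"

lemma run_violated:
  assumes "ok h"
  shows "calls_in P 6 [enc_list (enc_constraint \<rho>) cs, enc_assignment h]
    (enc_violated (violated cs h)) (700 * L ^ 4)"
proof -
  have "calls_in P 6 [enc_list (enc_constraint \<rho>) cs', enc_assignment h]
    (enc_violated (violated cs' h)) (350 * L ^ 3 * Suc (length cs'))" if "set cs' \<subseteq> set cs" for cs'
    using that
  proof (induction cs')
    case Nil
    show ?case using L_powers
      by (intro calls_inI[OF _ body]) (simp_all add: run_simps enc_violated_def violated_def)
  next
    case (Cons c cs')
    obtain s R where c: "c = (s, R)" by fastforce
    have R: "R \<in> \<Gamma>" "length s = arity R"
      using Cons.prems constraintD[of c] by (auto simp: c)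
    have len: "length s \<le> L" "\<rho> R \<le> L" using R arity_le \<rho>_le by auto
    let ?T = "trie A (length s) (\<lambda>t. map val t \<in> tuples R)"
    let ?b = "map val (map (lookup h) s) \<in> tuples R"
    obtain t\<^sub>1 where "t\<^sub>1 \<le> 8 * Suc (\<rho> R)" and
      "\<And>v' t'. call P 2 [enc_list (\<lambda>t. t) table, enc_nat (\<rho> R)] v' t' \<longleftrightarrow> v' = ?T \<and> t' = t\<^sub>1"
      using calls_inE[OF run_nth[OF table(1)[OF R(1)]]] unfolding table(2)[OF R(1)] R(2) by blast
    moreover obtain t\<^sub>2 where "t\<^sub>2 \<le> 300 * L ^ 3" and
      "\<And>v' t'. call P 5 [?T, enc_list enc_nat s, enc_assignment h] v' t'
        \<longleftrightarrow> v' = enc_bool ?b \<and> t' = t\<^sub>2"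
      using calls_inE[OF run_trie[OF assms len(1)]] by blast
    moreover obtain t\<^sub>3 where "t\<^sub>3 \<le> 350 * L ^ 3 * Suc (length cs')" and
      "\<And>v' t'. call P 6 [enc_list (enc_constraint \<rho>) cs', enc_assignment h] v' t'
        \<longleftrightarrow> v' = enc_violated (violated cs' h) \<and> t' = t\<^sub>3"
      using calls_inE[OF Cons.IH] Cons.prems by auto
    moreover have "violated (c # cs') h = (if ?b then violated cs' h else Some c)"
      by (simp add: violated_def c comp_def)
    moreover have "8 * Suc (\<rho> R) \<le> 16 * L ^ 3"
    proof -
      have "8 * Suc (\<rho> R) \<le> 16 * L" using len(2) L_pos by simp
      also have "\<dots> \<le> 16 * L ^ 3" using order_trans[OF L_powers(1,2)] by (rule mult_le_mono2)
      finally show ?thesis .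
    qed
    ultimately show ?case
      using L_powers
      by (intro calls_inI[OF _ body])
        (auto simp: c run_simps enc_constraint_def enc_violated_def algebra_simps)
  qed
  moreover have "350 * L ^ 3 * Suc (length cs) \<le> 700 * L ^ 4"
    using mult_Suc_le[of "length cs" "350 * L ^ 3"] cs_le by (simp add: L_pow4)
  ultimately show ?thesis
    by (auto intro: calls_in_mono)
qed

lemma run_meets:
  assumes "length g \<le> Suc k" and "ok h"
  shows "calls_in P 7 [enc_assignment g, enc_assignment h] (enc_bool (vars g \<inter> vars h \<noteq> {})) (300 * L ^ 3)"
proof -
  have "calls_in P 7 [enc_assignment g, enc_assignment h] (enc_bool (vars g \<inter> vars h \<noteq> {}))
      (150 * L ^ 2 * Suc (length g))"
  proof (induction g)
    case Nil
    show ?case using L_powers by (intro calls_inI[OF _ body]) (simp_all add: run_simps)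
  next
    case (Cons p g)
    obtain x a where p: "p = (x, a)" by fastforce
    \<comment> \<open>Function 4 doubles as a membership test, because a well-formed assignment
      stores nonzero values only.\<close>
    have x: "x \<in> vars h \<longleftrightarrow> lookup h x \<noteq> 0"
      using assms(2) wf_lookup_eq_0[of A n h x] by (auto simp: ok_def)
    obtain t\<^sub>1 where "t\<^sub>1 \<le> 100 * L ^ 2" and
      "\<And>v' t'. call P 4 [enc_assignment h, enc_nat x] v' t' \<longleftrightarrow> v' = enc_nat (lookup h x) \<and> t' = t\<^sub>1"
      using calls_inE[OF run_lookup[OF assms(2)]] by blast
    moreover obtain t\<^sub>2 where "t\<^sub>2 \<le> 150 * L ^ 2 * Suc (length g)" and
      "\<And>v' t'. call P 7 [enc_assignment g, enc_assignment h] v' t'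
        \<longleftrightarrow> v' = enc_bool (vars g \<inter> vars h \<noteq> {}) \<and> t' = t\<^sub>2"
      using calls_inE[OF Cons.IH] by blast
    ultimately show ?case
      using L_powers x
      by (intro calls_inI[OF _ body]; cases "lookup h x") (auto simp: p run_simps algebra_simps)
  qed
  moreover have "150 * L ^ 2 * Suc (length g) \<le> 300 * L ^ 3"
    using mult_Suc_le[of "length g" "150 * L ^ 2"] assms k_le
    by (simp add: power2_eq_square power3_eq_cube)
  ultimately show ?thesis
    by (auto intro: calls_in_mono)
qed

lemma run_same_type:
  assumes "ok g"
  shows "calls_in P 8 [enc_assignment g, enc_assignment h] (enc_bool (same_type g h)) (100 * L ^ 2)"
proof -
  have "calls_in P 8 [enc_assignment g, enc_assignment h] (enc_bool (same_type g h))
      (50 * L * Suc (length g))" if "snd ` set g \<subseteq> {1..A}"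
    using that
  proof (induction g arbitrary: h)
    case Nil
    show ?case using L_pos
      by (cases h) (intro calls_inI[OF _ body]; force simp: run_simps same_type_def)+
  next
    case (Cons p g)
    obtain x a where p: "p = (x, a)" by fastforce
    have a: "a \<le> L" "snd ` set g \<subseteq> {1..A}" using Cons.prems A_le by (auto simp: p)
    show ?case
    proof (cases h)
      case Nil
      then show ?thesis
        using L_pos by (intro calls_inI[OF _ body]) (simp_all add: p run_simps same_type_def)
    next
      case h: (Cons q h')
      obtain y b where q: "q = (y, b)" by fastforce
      obtain t\<^sub>1 where "t\<^sub>1 \<le> 24 * L" and
        "\<And>v' t'. call P 3 [enc_nat a, enc_nat b] v' t' \<longleftrightarrow> v' = enc_bool (a = b) \<and> t' = t\<^sub>1"
        using calls_inE[OF run_eq_nat[OF a(1), of "enc_nat b"]] by auto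
      moreover obtain t\<^sub>2 where "t\<^sub>2 \<le> 50 * L * Suc (length g)" and
        "\<And>v' t'. call P 8 [enc_assignment g, enc_assignment h'] v' t'
          \<longleftrightarrow> v' = enc_bool (same_type g h') \<and> t' = t\<^sub>2"
        using calls_inE[OF Cons.IH[OF a(2)]] by blast
      ultimately show ?thesis
        using L_pos
        by (intro calls_inI[OF _ body]; cases "a = b")
          (auto simp: p h q run_simps same_type_def algebra_simps)
    qed
  qed
  moreover have "50 * L * Suc (length g) \<le> 100 * L ^ 2"
    using mult_Suc_le[of "length g" "50 * L"] assms k_le by (simp add: ok_def power2_eq_square)
  ultimately show ?thesis
    using assms by (auto simp: ok_def wf_assignment_def intro: calls_in_mono)
qed

text \<open>\<open>c\<close> says how many more leaves of the type of \<open>g\<close> are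
  tolerated: each one found lowers it by one, and one found at zero refutes the condition. Hence the
  induction needs all \<open>c\<close>, not only \<open>k\<close>.\<close>

lemma run_admissible:
  assumes "ok g" and "\<And>f. f \<in> set F \<Longrightarrow> ok f" and "length F \<le> L"
  shows "calls_in P 9 [enc_assignment g, enc_list enc_assignment F, enc_nat c]
    (enc_bool ((\<forall>f\<in>set F. vars g \<inter> vars f = {}) \<and> length (filter (same_type g) F) \<le> c)) (900 * L ^ 4)"
proof -
  define M where "M = L ^ 3"
  have M: "300 * L ^ 3 = 300 * M" "100 * L ^ 2 \<le> 100 * M" "1 \<le> M"
    using L_powers by (simp_all add: M_def)
  have "calls_in P 9 [enc_assignment g, enc_list enc_assignment F, enc_nat c]
    (enc_bool ((\<forall>f\<in>set F. vars g \<inter> vars f = {}) \<and> length (filter (same_type g) F) \<le> c))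
    (450 * M * Suc (length F))"
    using assms(2)
  proof (induction F arbitrary: c)
    case Nil
    show ?case using M by (intro calls_inI[OF _ body]) (simp_all add: run_simps)
  next
    case (Cons f F)
    let ?b = "\<lambda>c. (\<forall>f\<in>set F. vars g \<inter> vars f = {}) \<and> length (filter (same_type g) F) \<le> c"
    have f: "ok f" "length g \<le> Suc k" using Cons.prems assms(1) by (auto simp: ok_def)
    obtain t\<^sub>1 where "t\<^sub>1 \<le> 300 * M" and
      "\<And>v' t'. call P 7 [enc_assignment g, enc_assignment f] v' t'
        \<longleftrightarrow> v' = enc_bool (vars g \<inter> vars f \<noteq> {}) \<and> t' = t\<^sub>1"
      using calls_inE[OF run_meets[OF f(2,1)]] unfolding M(1) by blast
    moreover obtain t\<^sub>2 where "t\<^sub>2 \<le> 100 * L ^ 2" and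
      "\<And>v' t'. call P 8 [enc_assignment g, enc_assignment f] v' t'
        \<longleftrightarrow> v' = enc_bool (same_type g f) \<and> t' = t\<^sub>2"
      using calls_inE[OF run_same_type[OF assms(1)]] by blast
    moreover have IH: "calls_in P 9 [enc_assignment g, enc_list enc_assignment F, enc_nat c]
        (enc_bool (?b c)) (450 * M * Suc (length F))" for c
      using Cons by simp
    moreover obtain t\<^sub>3 where "t\<^sub>3 \<le> 450 * M * Suc (length F)" and
      "\<And>v' t'. call P 9 [enc_assignment g, enc_list enc_assignment F, enc_nat c] v' t'
        \<longleftrightarrow> v' = enc_bool (?b c) \<and> t' = t\<^sub>3"
      using calls_inE[OF IH[of c]] by blast
    moreover obtain t\<^sub>4 where "t\<^sub>4 \<le> 450 * M * Suc (length F)" and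
      "\<And>v' t'. call P 9 [enc_assignment g, enc_list enc_assignment F, enc_nat (c - 1)] v' t'
        \<longleftrightarrow> v' = enc_bool (?b (c - 1)) \<and> t' = t\<^sub>4"
      using calls_inE[OF IH[of "c - 1"]] by blast
    ultimately show ?case
      using M(2,3)
      by (intro calls_inI[OF _ body]; cases "vars g \<inter> vars f = {}"; cases "same_type g f"; cases c)
        (simp_all add: run_simps algebra_simps)
  qed
  moreover have "450 * M * Suc (length F) \<le> 900 * L ^ 4"
    using mult_Suc_le[of "length F" "450 * M"] assms(3) by (simp add: M_def L_pow4)
  ultimately show ?thesis
    by (auto intro: calls_in_mono)
qed

text \<open>The first argument is the unread rest of the current leaf, hence the nested inductions.
  The extra unit per leaf in the bound pays for moving on to the next one.\<close>

lemma run_flat: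
  "calls_in P 10 [enc_assignment g, enc_list enc_assignment F]
    (enc_list enc_nat (map fst g @ concat (map (map fst) F)))
    (12 * Suc (length g + (\<Sum>f\<leftarrow>F. Suc (length f))))"
proof (induction F arbitrary: g)
  case Nil
  show ?case
  proof (induction g)
    case Nil
    show ?case by (intro calls_inI[OF _ body]) (simp_all add: run_simps)
  next
    case (Cons p g)
    obtain x a where p: "p = (x, a)" by fastforce
    obtain t where "t \<le> 12 * Suc (length g)" and
      "\<And>v' t'. call P 10 [enc_assignment g, Leaf] v' t' \<longleftrightarrow> v' = enc_list enc_nat (map fst g) \<and> t' = t"
      using calls_inE[OF Cons] by auto
    then show ?case by (intro calls_inI[OF _ body]) (simp_all add: p run_simps)
  qed
next
  case (Cons f F)
  show ?case
  proof (induction g)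
    case Nil
    obtain t where "t \<le> 12 * Suc (length f + (\<Sum>f\<leftarrow>F. Suc (length f)))" and
      "\<And>v' t'. call P 10 [enc_assignment f, enc_list enc_assignment F] v' t' \<longleftrightarrow>
        v' = enc_list enc_nat (map fst f @ concat (map (map fst) F)) \<and> t' = t"
      using calls_inE[OF Cons] by blast
    then show ?case by (intro calls_inI[OF _ body]) (simp_all add: run_simps)
  next
    case (Cons p g)
    obtain x a where p: "p = (x, a)" by fastforce
    obtain t where "t \<le> 12 * Suc (length g + (\<Sum>f\<leftarrow>f # F. Suc (length f)))" and
      "\<And>v' t'. call P 10 [enc_assignment g, enc_list enc_assignment (f # F)] v' t' \<longleftrightarrow>
        v' = enc_list enc_nat (map fst g @ concat (map (map fst) (f # F))) \<and> t' = t"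
      using calls_inE[OF Cons] by blast
    then show ?case by (intro calls_inI[OF _ body]) (simp_all add: p run_simps)
  qed
qed

end

text \<open>Cost of the search, abstracted over what is done with a visited assignment:
  \<open>pr\<close> updates an accumulator, \<open>E\<close> encodes it, and the tag
  \<open>m\<close> tells function 11 which update is meant. Both phases are instances, collecting
  with \<open>add_leaf\<close> and testing with a disjunction.\<close>

locale search_run = solver_run D z \<Gamma> vals \<rho> ke fe n cs k L
  for D :: "'d set" and z :: 'd and \<Gamma> :: "'d relation set" and vals :: "'d list"
    and \<rho> :: "'d relation \<Rightarrow> nat" and ke fe :: expr
    and n :: nat and cs :: "(nat, 'd) constraint list" and k L :: nat +
  fixes W :: "nat list" and b :: nat and m :: tree
    and E :: "'s \<Rightarrow> tree" and pr :: "assignment \<Rightarrow> 's \<Rightarrow> 's" and Inv :: "'s \<Rightarrow> bool"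
  assumes W_vars: "set W \<subseteq> {..<n}" and W_le: "length W \<le> b" and b_le: "b \<le> L"
    and arity_le_b: "\<And>R. R \<in> \<Gamma> \<Longrightarrow> arity R \<le> b"
    and Inv_pr: "\<And>g acc. ok g \<Longrightarrow> Inv acc \<Longrightarrow> Inv (pr g acc)"
    and run_pr: "\<And>g acc. ok g \<Longrightarrow> Inv acc \<Longrightarrow>
      calls_in P 11 [enc_assignment g, E acc, m] (E (pr g acc)) (1000 * L ^ 4)"
begin

text \<open>Raising \<open>j\<close> by one multiplies the time by \<open>1 + Suc b * Suc A\<close>:
  one share for the node itself, the others for its children. The successors also cover the calls at
  the ends of the two lists.\<close>

definition go_time :: "nat \<Rightarrow> nat" where
  "go_time j = 2200 * L ^ 4 * Suc (Suc b * Suc A) ^ j"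

abbreviation "encW \<equiv> enc_list enc_nat W"
abbreviation "encC \<equiv> enc_list (enc_constraint \<rho>) cs"

text \<open>Functions 12 to 14 are mutually recursive. The cycle is cut by assuming a bound
  \<open>T\<close> for the children here and in \<open>run_expand\<close>; \<open>run_go\<close>
  supplies it by induction on the fuel.\<close>

lemma run_vals:
  assumes "\<And>a acc. a \<in> set as \<Longrightarrow> Inv acc \<Longrightarrow>
      calls_in P 12 [enc_assignment ((x, a) # h), enc_nat j, E acc, encW, encC, m]
        (E (fold pr (r ((x, a) # h)) acc)) T \<and> Inv (fold pr (r ((x, a) # h)) acc)"
    and "Inv acc"
  shows "calls_in P 14
      [enc_list enc_nat as, enc_nat x, enc_assignment h, enc_nat j, E acc, encW, encC, m]
      (E (fold pr (concat (map (\<lambda>a. r ((x, a) # h)) as)) acc)) ((T + 30) * Suc (length as)) \<and>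
    Inv (fold pr (concat (map (\<lambda>a. r ((x, a) # h)) as)) acc)"
  using assms
proof (induction as arbitrary: acc)
  case Nil
  then show ?case by (auto intro!: calls_inI[OF _ body] simp: run_simps)
next
  case (Cons a as)
  let ?acc = "fold pr (r ((x, a) # h)) acc"
  have acc: "calls_in P 12 [enc_assignment ((x, a) # h), enc_nat j, E acc, encW, encC, m] (E ?acc) T"
    "Inv ?acc"
    using Cons.prems(1)[of a acc] Cons.prems(2) by auto
  have IH: "calls_in P 14
      [enc_list enc_nat as, enc_nat x, enc_assignment h, enc_nat j, E ?acc, encW, encC, m]
      (E (fold pr (concat (map (\<lambda>a. r ((x, a) # h)) as)) ?acc)) ((T + 30) * Suc (length as))"
    "Inv (fold pr (concat (map (\<lambda>a. r ((x, a) # h)) as)) ?acc)"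
    using Cons.IH[OF _ acc(2)] Cons.prems(1) by auto
  obtain t\<^sub>1 where "t\<^sub>1 \<le> T" and
    "\<And>v' t'. call P 12 [enc_assignment ((x, a) # h), enc_nat j, E acc, encW, encC, m] v' t'
      \<longleftrightarrow> v' = E ?acc \<and> t' = t\<^sub>1"
    using calls_inE[OF acc(1)] by blast
  moreover obtain t\<^sub>2 where "t\<^sub>2 \<le> (T + 30) * Suc (length as)" and
    "\<And>v' t'. call P 14
      [enc_list enc_nat as, enc_nat x, enc_assignment h, enc_nat j, E ?acc, encW, encC, m] v' t'
      \<longleftrightarrow> v' = E (fold pr (concat (map (\<lambda>a. r ((x, a) # h)) as)) ?acc) \<and> t' = t\<^sub>2"
    using calls_inE[OF IH(1)] by blast
  ultimately have "calls_in P 14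
      [enc_list enc_nat (a # as), enc_nat x, enc_assignment h, enc_nat j, E acc, encW, encC, m]
      (E (fold pr (concat (map (\<lambda>a. r ((x, a) # h)) (a # as))) acc)) ((T + 30) * Suc (length (a # as)))"
    by (intro calls_inI[OF _ body]) (simp_all add: run_simps)
  then show ?case using IH(2) by simp
qed

lemma run_expand:
  assumes "\<And>x a acc. x \<in> set s \<Longrightarrow> lookup h x = 0 \<Longrightarrow> a \<in> {1..A} \<Longrightarrow> Inv acc \<Longrightarrow>
      calls_in P 12 [enc_assignment ((x, a) # h), enc_nat j, E acc, encW, encC, m]
        (E (fold pr (r ((x, a) # h)) acc)) T \<and> Inv (fold pr (r ((x, a) # h)) acc)"
    and "Inv acc" and "ok h"
  shows "calls_in P 13
      [enc_list enc_nat s, enc_assignment h, enc_nat j, E acc, encW, encC, m]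
      (E (fold pr (expand A r s h) acc)) ((100 * L ^ 2 + (T + 30) * Suc A + 50) * Suc (length s)) \<and>
    Inv (fold pr (expand A r s h) acc)"
  using assms(1,2)
proof (induction s arbitrary: acc)
  case Nil
  then show ?case by (auto intro!: calls_inI[OF _ body] simp: run_simps expand_def)
next
  case (Cons x s)
  define X where "X = (T + 30) * Suc A"
  define Y where "Y = 100 * L ^ 2"
  define ls where "ls = concat (map (\<lambda>a. r ((x, a) # h)) [1..<Suc A])"
  define acc' where "acc' = (if lookup h x \<noteq> 0 then acc else fold pr ls acc)"
  obtain t\<^sub>1 where t\<^sub>1: "t\<^sub>1 \<le> Y"
    "\<And>v' t'. call P 4 [enc_assignment h, enc_nat x] v' t' \<longleftrightarrow> v' = enc_nat (lookup h x) \<and> t' = t\<^sub>1"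
    using calls_inE[OF run_lookup[OF assms(3)]] unfolding Y_def by blast
  have vals: "calls_in P 14 [enc_list enc_nat [1..<Suc A], enc_nat x, enc_assignment h, enc_nat j,
      E acc, encW, encC, m] (E acc') X \<and> Inv acc'" if "lookup h x = 0"
    using run_vals[of "[1..<Suc A]" x h j r T acc] Cons.prems that
    by (simp add: acc'_def ls_def X_def atLeastLessThanSuc_atLeastAtMost del: upt_Suc)
  then have "Inv acc'"
    using Cons.prems(2) by (cases "lookup h x = 0") (auto simp: acc'_def)
  then have IH: "calls_in P 13 [enc_list enc_nat s, enc_assignment h, enc_nat j, E acc', encW, encC, m]
      (E (fold pr (expand A r s h) acc')) ((Y + X + 50) * Suc (length s))"
    "Inv (fold pr (expand A r s h) acc')"
    using Cons.IH[of acc'] Cons.prems(1) by (auto simp: X_def Y_def)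
  obtain t\<^sub>2 where t\<^sub>2: "t\<^sub>2 \<le> (Y + X + 50) * Suc (length s)"
    "\<And>v' t'. call P 13 [enc_list enc_nat s, enc_assignment h, enc_nat j, E acc', encW, encC, m] v' t'
      \<longleftrightarrow> v' = E (fold pr (expand A r s h) acc') \<and> t' = t\<^sub>2"
    using calls_inE[OF IH(1)] by blast
  have fold: "fold pr (expand A r (x # s) h) acc = fold pr (expand A r s h) acc'"
    by (simp add: expand_def acc'_def ls_def)
  have "calls_in P 13 [enc_list enc_nat (x # s), enc_assignment h, enc_nat j, E acc, encW, encC, m]
      (E (fold pr (expand A r s h) acc')) ((Y + X + 50) * Suc (length (x # s)))"
  proof (cases "lookup h x")
    case 0
    obtain t\<^sub>3 where "t\<^sub>3 \<le> X"
      "\<And>v' t'. call P 14 [enc_list enc_nat [1..<Suc A], enc_nat x, enc_assignment h, enc_nat j,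
        E acc, encW, encC, m] v' t' \<longleftrightarrow> v' = E acc' \<and> t' = t\<^sub>3"
      using calls_inE[OF vals[OF 0, THEN conjunct1]] by blast
    then show ?thesis
      using t\<^sub>1 t\<^sub>2 0 by (intro calls_inI[OF _ body]) (simp_all add: run_simps algebra_simps del: upt_Suc)
  next
    case (Suc i)
    then have "acc' = acc" by (simp add: acc'_def)
    then show ?thesis
      using t\<^sub>1 t\<^sub>2 Suc by (intro calls_inI[OF _ body]) (simp_all add: run_simps algebra_simps del: upt_Suc)
  qed
  then show ?case using IH(2) unfolding fold X_def Y_def by blast
qed

lemma go_time_Suc: "go_time (Suc j) = go_time j + go_time j * (Suc b * Suc A)"
proof -
  have "x * Suc c ^ Suc j = x * Suc c ^ j + x * Suc c ^ j * c" for x c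
    by (simp add: algebra_simps)
  then show ?thesis unfolding go_time_def .
qed

text \<open>The summand \<open>1775 * L ^ 4\<close> pays for the node: 700 for finding a violated
  constraint, 1000 for processing the assignment and 75 for single steps.\<close>

lemma expand_time_le:
  assumes "len \<le> b"
  shows "(100 * L ^ 2 + (go_time j + 30) * Suc A + 50) * Suc len + 1775 * L ^ 4 \<le> go_time (Suc j)"
proof -
  have sA: "Suc A \<le> 2 * L" and sb: "Suc len \<le> 2 * L"
    using A_le b_le L_pos assms by auto
  \<comment> \<open>With the products as atoms the problem is linear: 200 + 120 + 100 + 1775 stays
    below 2200.\<close>
  have arith: "x + 1775 * l\<^sub>4 \<le> g + q'"
    if "x = 100 * p + q + 30 * r + 50 * s" "p \<le> 2 * l\<^sub>3" "q \<le> q'" "r \<le> 4 * l\<^sub>2"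
      "2200 * l\<^sub>4 \<le> g" "s \<le> 2 * L" "L \<le> l\<^sub>2" "l\<^sub>2 \<le> l\<^sub>3" "l\<^sub>3 \<le> l\<^sub>4" for x g p q r s q' l\<^sub>2 l\<^sub>3 l\<^sub>4
    using that by linarith
  have "(100 * L ^ 2 + (go_time j + 30) * Suc A + 50) * Suc len =
      100 * (L ^ 2 * Suc len) + go_time j * (Suc len * Suc A) + 30 * (Suc len * Suc A) + 50 * Suc len"
    by (simp only: algebra_simps)
  moreover have "L ^ 2 * Suc len \<le> 2 * L ^ 3"
    using mult_le_mono2[OF sb, of "L ^ 2"] by (simp add: power2_eq_square power3_eq_cube)
  moreover have "go_time j * (Suc len * Suc A) \<le> go_time j * (Suc b * Suc A)"
    using assms by (intro mult_le_mono) auto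
  moreover have "Suc len * Suc A \<le> 4 * L ^ 2"
    using mult_le_mono[OF sb sA] by (simp add: power2_eq_square)
  moreover have "2200 * L ^ 4 \<le> go_time j" by (simp add: go_time_def)
  ultimately show ?thesis
    unfolding go_time_Suc using sb L_powers(1-3) by (rule arith)
qed

text \<open>\<open>length h + j\<close> is constant along a branch, as a child gains one variable
  and loses one unit of fuel; so all visited assignments are \<open>ok\<close>. The bound is
  \<open>Suc k\<close> because the leaf search starts with one variable and fuel
  \<open>k\<close>.\<close>

lemma run_go:
  assumes "wf_assignment A n h" and "length h + j \<le> Suc k" and "Inv acc"
  shows "calls_in P 12 [enc_assignment h, enc_nat j, E acc, encW, encC, m]
      (E (fold pr (visits cs W j h) acc)) (go_time j) \<and> Inv (fold pr (visits cs W j h) acc)"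
  using assms
proof (induction j arbitrary: h acc)
  case 0
  then have h: "ok h" by (simp add: ok_def)
  obtain t\<^sub>1 where "t\<^sub>1 \<le> 700 * L ^ 4"
    "\<And>v' t'. call P 6 [encC, enc_assignment h] v' t' \<longleftrightarrow> v' = enc_violated (violated cs h) \<and> t' = t\<^sub>1"
    using calls_inE[OF run_violated[OF h]] by blast
  moreover obtain t\<^sub>2 where "t\<^sub>2 \<le> 1000 * L ^ 4"
    "\<And>v' t'. call P 11 [enc_assignment h, E acc, m] v' t' \<longleftrightarrow> v' = E (pr h acc) \<and> t' = t\<^sub>2"
    using calls_inE[OF run_pr[OF h 0(3)]] by blast
  ultimately have "calls_in P 12 [enc_assignment h, enc_nat 0, E acc, encW, encC, m]
      (E (fold pr (visits cs W 0 h) acc)) (go_time 0)"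
    using L_powers
    by (intro calls_inI[OF _ body]; cases "violated cs h")
      (auto simp: run_simps enc_violated_def go_time_def enc_constraint_def split: prod.splits)
  moreover have "Inv (fold pr (visits cs W 0 h) acc)"
    using 0(3) Inv_pr[OF h] by (auto split: option.splits)
  ultimately show ?case by blast
next
  case (Suc j)
  then have h: "ok h" by (simp add: ok_def)
  define T where "T = (100 * L ^ 2 + (go_time j + 30) * Suc A + 50)"
  have branch: "calls_in P 13 [enc_list enc_nat s, enc_assignment h, enc_nat j, E acc, encW, encC, m]
      (E (fold pr (expand A (visits cs W j) s h) acc)) (T * Suc (length s)) \<and>
    Inv (fold pr (expand A (visits cs W j) s h) acc)"
    if "set s \<subseteq> {..<n}" and "Inv acc" for s acc
    unfolding T_def
  proof (rule run_expand[OF _ that(2) h])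
    fix x a acc
    assume *: "x \<in> set s" "lookup h x = 0" "a \<in> {1..A}" "Inv acc"
    then have "wf_assignment A n ((x, a) # h)"
      using that(1) Suc.prems(1) by (intro wf_assignment_Cons) auto
    then show "calls_in P 12 [enc_assignment ((x, a) # h), enc_nat j, E acc, encW, encC, m]
        (E (fold pr (visits cs W j ((x, a) # h)) acc)) (go_time j) \<and>
      Inv (fold pr (visits cs W j ((x, a) # h)) acc)"
      using Suc.prems(2) *(4) by (intro Suc.IH) auto
  qed
  have time: "T * Suc (length s) + 1775 * L ^ 4 \<le> go_time (Suc j)" if "length s \<le> b" for s :: "nat list"
    using expand_time_le[OF that] unfolding T_def .
  obtain t\<^sub>1 where t\<^sub>1: "t\<^sub>1 \<le> 700 * L ^ 4"
    "\<And>v' t'. call P 6 [encC, enc_assignment h] v' t' \<longleftrightarrow> v' = enc_violated (violated cs h) \<and> t' = t\<^sub>1"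
    using calls_inE[OF run_violated[OF h]] by blast
  show ?case
  proof (cases "violated cs h")
    case None
    note acc = Inv_pr[OF h Suc.prems(3)]
    obtain t\<^sub>2 where t\<^sub>2: "t\<^sub>2 \<le> 1000 * L ^ 4"
      "\<And>v' t'. call P 11 [enc_assignment h, E acc, m] v' t' \<longleftrightarrow> v' = E (pr h acc) \<and> t' = t\<^sub>2"
      using calls_inE[OF run_pr[OF h Suc.prems(3)]] by blast
    obtain t\<^sub>3 where t\<^sub>3: "t\<^sub>3 \<le> T * Suc (length W)"
      "\<And>v' t'. call P 13 [encW, enc_assignment h, enc_nat j, E (pr h acc), encW, encC, m] v' t' \<longleftrightarrow>
        v' = E (fold pr (expand A (visits cs W j) W h) (pr h acc)) \<and> t' = t\<^sub>3"
      using calls_inE[OF branch[OF W_vars acc, THEN conjunct1]] by blast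
    have "calls_in P 12 [enc_assignment h, enc_nat (Suc j), E acc, encW, encC, m]
        (E (fold pr (visits cs W (Suc j) h) acc)) (go_time (Suc j))"
      using t\<^sub>1 t\<^sub>2 t\<^sub>3 time[OF W_le] L_powers None
      by (intro calls_inI[OF _ body]) (simp_all add: run_simps enc_violated_def)
    then show ?thesis
      using branch[OF W_vars acc] None by simp
  next
    case (Some c)
    obtain s R where c: "c = (s, R)" by fastforce
    have s: "set s \<subseteq> {..<n}" "length s \<le> b"
      using constraintD[OF violated_Some(1)[OF Some]] arity_le_b c by auto
    obtain t\<^sub>3 where t\<^sub>3: "t\<^sub>3 \<le> T * Suc (length s)"
      "\<And>v' t'. call P 13 [enc_list enc_nat s, enc_assignment h, enc_nat j, E acc, encW, encC, m] v' t' \<longleftrightarrow>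
        v' = E (fold pr (expand A (visits cs W j) s h) acc) \<and> t' = t\<^sub>3"
      using calls_inE[OF branch[OF s(1) Suc.prems(3), THEN conjunct1]] by blast
    have "calls_in P 12 [enc_assignment h, enc_nat (Suc j), E acc, encW, encC, m]
        (E (fold pr (visits cs W (Suc j) h) acc)) (go_time (Suc j))"
      using t\<^sub>1 t\<^sub>3 time[OF s(2)] L_powers Some
      by (intro calls_inI[OF _ body]) (simp_all add: run_simps enc_violated_def c enc_constraint_def)
    then show ?thesis
      using branch[OF s(1) Suc.prems(3)] Some c by simp
  qed
qed

end

section \<open>The two phases and the complete run\<close>

context solver_run
begin

text \<open>A tag with \<open>Leaf\<close> on the left makes function 11 collect; its right part
  carries the capacity \<open>k\<close>.\<close>

lemma run_collect:
  assumes "ok g" and "\<forall>f\<in>set F. ok f" and "length F \<le> L"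
  shows "calls_in P 11 [enc_assignment g, enc_list enc_assignment F, Node Leaf (enc_nat k)]
    (enc_list enc_assignment (add_leaf k g F)) (1000 * L ^ 4)"
proof -
  obtain t where "t \<le> 900 * L ^ 4"
    "\<And>v' t'. call P 9 [enc_assignment g, enc_list enc_assignment F, enc_nat k] v' t' \<longleftrightarrow>
      v' = enc_bool ((\<forall>f\<in>set F. vars g \<inter> vars f = {}) \<and> length (filter (same_type g) F) \<le> k) \<and> t' = t"
    using calls_inE[OF run_admissible[of g F k]] assms by blast
  then show ?thesis
    using L_powers
    by (intro calls_inI[OF _ body];
        cases "(\<forall>f\<in>set F. vars g \<inter> vars f = {}) \<and> length (filter (same_type g) F) \<le> k")
      (auto simp: run_simps add_leaf_def)
qed

text \<open>A tag with a \<open>Node\<close> on the left makes function 11 test; after the first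
  success the accumulator is passed on without further tests.\<close>

lemma run_test:
  assumes "calls_in P 15 [enc_assignment g, q] (enc_bool Q) (900 * L ^ 4)"
  shows "calls_in P 11 [enc_assignment g, enc_bool b, Node (Node Leaf Leaf) q] (enc_bool (b \<or> Q))
    (1000 * L ^ 4)"
proof -
  obtain t where "t \<le> 900 * L ^ 4"
    "\<And>v' t'. call P 15 [enc_assignment g, q] v' t' \<longleftrightarrow> v' = enc_bool Q \<and> t' = t"
    using calls_inE[OF assms] by blast
  then show ?thesis
    using L_powers by (intro calls_inI[OF _ body]; cases b) (auto simp: run_simps)
qed

lemma fold_disj: "fold (\<lambda>g b. b \<or> Q g) gs b \<longleftrightarrow> b \<or> (\<exists>g\<in>set gs. Q g)"
  by (induction gs arbitrary: b) auto

text \<open>The lower bound on \<open>b\<close> is a bound for the kernel: \<open>Suc k\<close>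
  variables in a leaf, \<open>Suc k\<close> leaves of a type and \<open>Suc A ^ Suc k\<close>
  types.\<close>

lemma run_main:
  assumes ke: "\<exists>t\<le>10. eval P [x] ke (enc_nat k) t"
    and x: "x = Node (Node (enc_nat n) (enc_list (enc_constraint \<rho>) cs)) q"
    and Q: "\<And>g. ok g \<Longrightarrow> calls_in P 15 [enc_assignment g, q] (enc_bool (Q g)) (900 * L ^ 4)"
    and b: "Suc k * (Suc k * Suc A ^ Suc k) \<le> b" "b \<le> L" "\<And>R. R \<in> \<Gamma> \<Longrightarrow> arity R \<le> b"
  shows "calls_in P 0 [x] (enc_bool (\<exists>g\<in>set (visits cs (kernel n cs k) k []). Q g))
    (22000 * L ^ 6 * Suc (Suc b * Suc A) ^ k)"
proof -
  let ?C = "enc_list (enc_constraint \<rho>) cs"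
  \<comment> \<open>The cap on the family has to be an invariant, because every call of
    \<open>add_leaf\<close> scans the family collected so far.\<close>
  define Inv where "Inv F \<longleftrightarrow> (\<forall>f\<in>set F. ok f) \<and> few_of_each_type k F" for F
  have len: "length F \<le> Suc k * Suc A ^ Suc k" if "Inv F" for F
    using that length_few_of_each_type[of k F A] by (auto simp: Inv_def ok_def wf_assignment_def)
  have "Suc k * Suc A ^ Suc k \<le> Suc k * (Suc k * Suc A ^ Suc k)" by simp
  with b have cap: "Suc k * Suc A ^ Suc k \<le> L" by linarith
  interpret collect: search_run D z \<Gamma> vals \<rho> ke fe n cs k L "[]" b "Node Leaf (enc_nat k)"
      "enc_list enc_assignment" "add_leaf k" Inv
  proof
    fix g F assume g: "ok g" and F: "Inv F"
    show "Inv (add_leaf k g F)"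
      using F g few_of_each_type_add_leaf[of k F g] by (auto simp: Inv_def add_leaf_def)
    show "calls_in P 11 [enc_assignment g, enc_list enc_assignment F, Node Leaf (enc_nat k)]
      (enc_list enc_assignment (add_leaf k g F)) (1000 * L ^ 4)"
      using g F len[OF F] cap by (intro run_collect) (auto simp: Inv_def)
  qed (use b in auto)
  define T where "T = collect.go_time k"
  have T: "2200 * L ^ 4 \<le> T" by (simp add: T_def collect.go_time_def)
  have leaves: "calls_in P 13 [enc_list enc_nat (rev [0..<n]), Leaf, enc_nat k, Leaf, Leaf, ?C,
        Node Leaf (enc_nat k)] (enc_list enc_assignment (family n cs k))
        ((100 * L ^ 2 + (T + 30) * Suc A + 50) * Suc n) \<and> Inv (family n cs k)"
  proof -
    have "calls_in P 12 [enc_assignment [(x, a)], enc_nat k, enc_list enc_assignment acc,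
          enc_list enc_nat [], ?C, Node Leaf (enc_nat k)]
        (enc_list enc_assignment (fold (add_leaf k) (visits cs [] k [(x, a)]) acc)) T \<and>
        Inv (fold (add_leaf k) (visits cs [] k [(x, a)]) acc)"
      if "x < n" "a \<in> {1..A}" "Inv acc" for x a acc
      using collect.run_go[of "[(x, a)]" k acc] that by (simp add: wf_assignment_def T_def)
    moreover have "Inv []" by (simp add: Inv_def few_of_each_type_def)
    ultimately show ?thesis
      using collect.run_expand[of "rev [0..<n]" "[]" k "visits cs [] k" T "[]"]
      by (simp add: leaves_def family_def ok_def)
  qed
  then have Inv: "Inv (family n cs k)" by blast
  have len_f: "length f \<le> Suc k" if "f \<in> set (family n cs k)" for f
    using Inv that by (auto simp: Inv_def ok_def)
  have "(\<Sum>f\<leftarrow>family n cs k. Suc (length f)) \<le> (\<Sum>f\<leftarrow>family n cs k. Suc (Suc k))"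
    using len_f by (intro sum_list_mono) auto
  also have "\<dots> = length (family n cs k) * Suc (Suc k)"
    unfolding sum_list_triv of_nat_id ..
  also have "\<dots> \<le> L * (2 * L)"
    using order_trans[OF len[OF Inv] cap] k_le L_pos by (intro mult_le_mono) simp_all
  finally have flat_time: "(\<Sum>f\<leftarrow>family n cs k. Suc (length f)) \<le> 2 * L ^ 2"
    by (simp add: power2_eq_square)
  have "length (kernel n cs k) = (\<Sum>f\<leftarrow>family n cs k. length f)"
    by (simp add: kernel_def length_concat comp_def)
  also have "\<dots> \<le> (\<Sum>f\<leftarrow>family n cs k. Suc k)"
    using len_f by (intro sum_list_mono) auto
  also have "\<dots> = Suc k * length (family n cs k)"
    unfolding sum_list_triv of_nat_id by (rule mult.commute)
  also have "\<dots> \<le> Suc k * (Suc k * Suc A ^ Suc k)"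
    by (rule mult_le_mono2[OF len[OF Inv]])
  finally have kernel_le: "length (kernel n cs k) \<le> b" using b(1) by simp
  have kernel_vars: "set (kernel n cs k) \<subseteq> {..<n}"
    using Inv by (auto simp: set_kernel Inv_def ok_def wf_assignment_def)
  interpret test: search_run D z \<Gamma> vals \<rho> ke fe n cs k L "kernel n cs k" b
      "Node (Node Leaf Leaf) q" enc_bool "\<lambda>g acc. acc \<or> Q g" "\<lambda>_. True"
    by unfold_locales (use b kernel_le kernel_vars run_test[OF Q] in auto)
  have T_test: "test.go_time k = T"
    by (simp add: T_def collect.go_time_def test.go_time_def)
  obtain t\<^sub>1 where t\<^sub>1: "t\<^sub>1 \<le> 10" "\<And>v' t'. eval P [x] ke v' t' \<longleftrightarrow> v' = enc_nat k \<and> t' = t\<^sub>1"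
    using ke by (auto simp: eval_iff)
  obtain t\<^sub>2 where t\<^sub>2: "t\<^sub>2 \<le> 10 * Suc n"
    "\<And>v' t'. call P 1 [enc_nat n] v' t' \<longleftrightarrow> v' = enc_list enc_nat (rev [0..<n]) \<and> t' = t\<^sub>2"
    using calls_inE[OF run_vars] by blast
  obtain t\<^sub>3 where t\<^sub>3: "t\<^sub>3 \<le> (100 * L ^ 2 + (T + 30) * Suc A + 50) * Suc n"
    "\<And>v' t'. call P 13 [enc_list enc_nat (rev [0..<n]), Leaf, enc_nat k, Leaf, Leaf, ?C,
        Node Leaf (enc_nat k)] v' t' \<longleftrightarrow> v' = enc_list enc_assignment (family n cs k) \<and> t' = t\<^sub>3"
    using calls_inE[OF leaves[THEN conjunct1]] by blast
  obtain t\<^sub>4 where t\<^sub>4: "t\<^sub>4 \<le> 12 * Suc (2 * L ^ 2)"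
    "\<And>v' t'. call P 10 [Leaf, enc_list enc_assignment (family n cs k)] v' t' \<longleftrightarrow>
      v' = enc_list enc_nat (kernel n cs k) \<and> t' = t\<^sub>4"
  proof (rule calls_inE[OF calls_in_mono[OF run_flat[of "[]" "family n cs k"]]])
    show "12 * Suc (length ([] :: assignment) + (\<Sum>f\<leftarrow>family n cs k. Suc (length f)))
        \<le> 12 * Suc (2 * L ^ 2)"
      using flat_time by simp
  qed (auto simp: kernel_def intro: that)
  obtain t\<^sub>5 where t\<^sub>5: "t\<^sub>5 \<le> T"
    "\<And>v' t'. call P 12 [Leaf, enc_nat k, Leaf, enc_list enc_nat (kernel n cs k), ?C,
        Node (Node Leaf Leaf) q] v' t' \<longleftrightarrow>
      v' = enc_bool (\<exists>g\<in>set (visits cs (kernel n cs k) k []). Q g) \<and> t' = t\<^sub>5"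
    using calls_inE[OF test.run_go[of "[]" k False, THEN conjunct1, unfolded T_test fold_disj]]
    by auto
  have "calls_in P 0 [x] (enc_bool (\<exists>g\<in>set (visits cs (kernel n cs k) k []). Q g))
      (t\<^sub>1 + t\<^sub>1 + t\<^sub>1 + t\<^sub>2 + t\<^sub>3 + t\<^sub>4 + t\<^sub>5 + 60)"
    using t\<^sub>1(2) t\<^sub>2(2) t\<^sub>3(2) t\<^sub>4(2) t\<^sub>5(2) x by (intro calls_inI[OF _ body]) (simp_all add: run_simps)
  \<comment> \<open>The leaf phase dominates: it starts a search of cost \<open>T\<close> for every
    variable and nonzero value, and \<open>Suc n * Suc A\<close> is at most
    \<open>4 * L ^ 2\<close>.\<close>
  moreover have "t\<^sub>1 + t\<^sub>1 + t\<^sub>1 + t\<^sub>2 + t\<^sub>3 + t\<^sub>4 + t\<^sub>5 + 60 \<le> 10 * (L ^ 2 * T)"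
  proof -
    have sA: "Suc A \<le> 2 * L" and sn: "Suc n \<le> 2 * L"
      using A_le n_le L_pos by auto
    have "t\<^sub>3 \<le> (100 * L ^ 2 + (T + 30) * (2 * L) + 50) * (2 * L)"
      by (rule order_trans[OF t\<^sub>3(1)]) (intro mult_le_mono add_mono order_refl sA sn)
    also have "\<dots> = 200 * L ^ 3 + 4 * (L ^ 2 * T) + 120 * L ^ 2 + 100 * L"
      by (simp add: algebra_simps power2_eq_square power3_eq_cube)
    finally have "t\<^sub>3 \<le> 4 * (L ^ 2 * T) + 420 * L ^ 4"
      using L_powers by simp
    moreover have "t\<^sub>2 \<le> 10 * n + 10" "n + 1 \<le> 2 * L" "t\<^sub>4 \<le> 24 * L ^ 2 + 12"
      using t\<^sub>2(1) t\<^sub>4(1) sn by simp_all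
    moreover have "T \<le> L ^ 2 * T" using L_powers(4) by simp
    ultimately show ?thesis using t\<^sub>5(1) T t\<^sub>1(1) L_powers by linarith
  qed
  moreover have "10 * (L ^ 2 * T) = 22000 * L ^ 6 * Suc (Suc b * Suc A) ^ k"
  proof -
    have "10 * (l\<^sub>2 * (2200 * l\<^sub>4 * y)) = 22000 * (l\<^sub>2 * l\<^sub>4) * y" for l\<^sub>2 l\<^sub>4 y :: nat by simp
    moreover have "L ^ 6 = L ^ 2 * L ^ 4" by (simp flip: power_add)
    ultimately show ?thesis unfolding T_def collect.go_time_def by metis
  qed
  ultimately show ?thesis
    by (auto intro: calls_in_mono)
qed

end

section \<open>The final tests of the two problems\<close>

context solver_run
begin

lemma body_15: "P ! 15 = fe"
  by (simp add: body)

lemma run_size_test: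
  assumes "fe = Call 3 [Var 0, Var 1]" and "ok g"
  shows "calls_in P 15 [enc_assignment g, enc_nat k'] (enc_bool (length g = k')) (900 * L ^ 4)"
proof -
  obtain t where "t \<le> 12 * Suc (length g)"
    "\<And>v' t'. call P 3 [enc_assignment g, enc_nat k'] v' t' \<longleftrightarrow> v' = enc_bool (length g = k') \<and> t' = t"
    using calls_inE[OF run_eq[of "enc_assignment g" "enc_nat k'"]] by (auto simp: enc_assignment_def)
  moreover have "length g \<le> L ^ 4"
    using assms(2) k_le L_powers by (simp add: ok_def)
  ultimately show ?thesis
    using L_powers by (intro calls_inI[OF _ trans[OF body_15 assms(1)]]) (simp_all add: run_simps)
qed

lemma run_count:
  assumes "ok g"
  shows "calls_in P 16 [enc_assignment g, enc_nat i] (enc_nat (count_list (map snd g) i)) (100 * L ^ 2)"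
proof -
  have "calls_in P 16 [enc_assignment g, enc_nat i] (enc_nat (count_list (map snd g) i))
      (50 * L * Suc (length g))" if "snd ` set g \<subseteq> {1..A}"
    using that
  proof (induction g)
    case Nil
    show ?case using L_pos by (intro calls_inI[OF _ body]) (simp_all add: run_simps)
  next
    case (Cons p g)
    obtain x a where p: "p = (x, a)" by fastforce
    have a: "a \<le> L" "snd ` set g \<subseteq> {1..A}" using Cons.prems A_le by (auto simp: p)
    obtain t\<^sub>1 where "t\<^sub>1 \<le> 24 * L" and
      "\<And>v' t'. call P 3 [enc_nat a, enc_nat i] v' t' \<longleftrightarrow> v' = enc_bool (a = i) \<and> t' = t\<^sub>1"
      using calls_inE[OF run_eq_nat[OF a(1), of "enc_nat i"]] by auto
    moreover obtain t\<^sub>2 where "t\<^sub>2 \<le> 50 * L * Suc (length g)" and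
      "\<And>v' t'. call P 16 [enc_assignment g, enc_nat i] v' t'
        \<longleftrightarrow> v' = enc_nat (count_list (map snd g) i) \<and> t' = t\<^sub>2"
      using calls_inE[OF Cons.IH[OF a(2)]] by blast
    ultimately show ?case
      using L_pos by (intro calls_inI[OF _ body]; cases "a = i") (auto simp: p run_simps algebra_simps)
  qed
  moreover have "50 * L * Suc (length g) \<le> 100 * L ^ 2"
    using mult_Suc_le[of "length g" "50 * L"] assms k_le by (simp add: ok_def power2_eq_square)
  ultimately show ?thesis
    using assms by (auto simp: ok_def wf_assignment_def intro: calls_in_mono)
qed

lemma run_profile:
  assumes "ok g"
  shows "calls_in P 17 [enc_assignment g, enc_nat i, enc_list enc_nat ps]
    (enc_bool (\<forall>j<length ps. count_list (map snd g) (i + j) = ps ! j)) (150 * L ^ 2 * Suc (length ps))"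
proof (induction ps arbitrary: i)
  case Nil
  show ?case using L_powers by (intro calls_inI[OF _ body]) (simp_all add: run_simps)
next
  case (Cons p ps)
  let ?c = "count_list (map snd g) i"
  let ?b = "\<forall>j<length ps. count_list (map snd g) (Suc i + j) = ps ! j"
  \<comment> \<open>The count is bounded through the length of \<open>g\<close>, while no bound is
    known for \<open>p\<close>; so the count comes first in the comparison.\<close>
  have c: "?c \<le> L"
    using count_le_length[of "map snd g" i] assms k_le by (simp add: ok_def)
  obtain t\<^sub>1 where "t\<^sub>1 \<le> 100 * L ^ 2" and
    "\<And>v' t'. call P 16 [enc_assignment g, enc_nat i] v' t' \<longleftrightarrow> v' = enc_nat ?c \<and> t' = t\<^sub>1"
    using calls_inE[OF run_count[OF assms]] by blast
  moreover obtain t\<^sub>2 where "t\<^sub>2 \<le> 24 * L" and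
    "\<And>v' t'. call P 3 [enc_nat ?c, enc_nat p] v' t' \<longleftrightarrow> v' = enc_bool (?c = p) \<and> t' = t\<^sub>2"
    using calls_inE[OF run_eq_nat[OF c, of "enc_nat p"]] by auto
  moreover obtain t\<^sub>3 where "t\<^sub>3 \<le> 150 * L ^ 2 * Suc (length ps)" and
    "\<And>v' t'. call P 17 [enc_assignment g, Node Leaf (enc_nat i), enc_list enc_nat ps] v' t'
      \<longleftrightarrow> v' = enc_bool ?b \<and> t' = t\<^sub>3"
    using calls_inE[OF Cons.IH[of "Suc i"]] by auto
  ultimately have "calls_in P 17 [enc_assignment g, enc_nat i, enc_list enc_nat (p # ps)]
      (enc_bool (?c = p \<and> ?b)) (150 * L ^ 2 * Suc (length (p # ps)))"
    using L_powers
    by (intro calls_inI[OF _ body]; cases "?c = p") (simp_all add: run_simps algebra_simps)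
  moreover have "(\<forall>j<length (p # ps). count_list (map snd g) (i + j) = (p # ps) ! j) \<longleftrightarrow> ?c = p \<and> ?b"
    by (simp add: All_less_Suc2)
  ultimately show ?case by simp
qed

lemma run_profile_test:
  assumes "fe = Call 17 [Var 0, Quote (enc_nat 1), LeftOf (Var 1)]" and "ok g" and "length ps = A"
  shows "calls_in P 15 [enc_assignment g, Node (enc_list enc_nat ps) r]
    (enc_bool (\<forall>j<A. count_list (map snd g) (Suc j) = ps ! j)) (900 * L ^ 4)"
proof -
  have "150 * L ^ 2 * Suc (length ps) \<le> 300 * L ^ 3"
    using mult_Suc_le[of "length ps" "150 * L ^ 2"] assms(3) A_le
    by (simp add: power2_eq_square power3_eq_cube)
  then obtain t where "t \<le> 300 * L ^ 3"
    "\<And>v' t'. call P 17 [enc_assignment g, Node Leaf Leaf, enc_list enc_nat ps] v' t' \<longleftrightarrow>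
      v' = enc_bool (\<forall>j<A. count_list (map snd g) (Suc j) = ps ! j) \<and> t' = t"
    using calls_inE[OF calls_in_mono[OF run_profile[OF assms(2), of 1 ps]]] assms(3) by auto
  then show ?thesis
    using L_powers by (intro calls_inI[OF _ trans[OF body_15 assms(1)]]) (simp_all add: run_simps)
qed

end


section \<open>Fixed-parameter tractability\<close>

context solver
begin

text \<open>A constant of the problem: it depends on the language, its numbering and the domain, but
  not on the input.\<close>

definition language_size :: nat where
  "language_size = Suc (Max (insert 0 (\<rho> ` \<Gamma>)) + Max (insert 0 (arity ` \<Gamma>)) + A)"

text \<open>The kernel bound from \<open>run_main\<close>, plus a constant that makes it exceed all
  arities as well.\<close>

definition branching :: arith where
  "branching = (let k = Add Param (Const 1) in
     Add (Const language_size) (Mult k (Mult k (Power (Const (Suc A)) k))))"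

text \<open>The 22000 of \<open>run_main\<close>, raised by 2 for the steps of the outermost
  call.\<close>

definition time :: arith where
  "time = Mult (Mult (Const 22002) (Power branching (Const 6)))
     (Power (Add (Const 1) (Mult (Add (Const 1) branching) (Const (Suc A)))) Param)"

lemma branching_val:
  "arith_val branching k = language_size + Suc k * (Suc k * Suc A ^ Suc k)"
  by (simp add: branching_def Let_def)

lemma time_val:
  "arith_val time k = 22002 * arith_val branching k ^ 6 * Suc (Suc (arith_val branching k) * Suc A) ^ k"
  by (simp add: time_def)

lemma language_size:
  shows "R \<in> \<Gamma> \<Longrightarrow> \<rho> R \<le> language_size" and "R \<in> \<Gamma> \<Longrightarrow> arity R \<le> language_size"
    and "A \<le> language_size"
proof -
  have "\<rho> R \<le> Max (insert 0 (\<rho> ` \<Gamma>))" "arity R \<le> Max (insert 0 (arity ` \<Gamma>))" if "R \<in> \<Gamma>" for R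
    using that finite_\<Gamma> by (auto intro!: Max_ge)
  then show "R \<in> \<Gamma> \<Longrightarrow> \<rho> R \<le> language_size" "R \<in> \<Gamma> \<Longrightarrow> arity R \<le> language_size"
    "A \<le> language_size"
    by (fastforce simp: language_size_def)+
qed

text \<open>\<open>L\<close> is chosen as a function of \<open>k\<close> times the input size, so
  that \<open>L ^ 6\<close> splits into a part absorbed by \<open>time\<close> and the factor
  \<open>Suc (size x) ^ 6\<close>.\<close>

lemma decides:
  assumes inst: "input_instance \<Gamma> (n, cs)"
    and x: "x = Node (enc_instance \<rho> (n, cs)) q"
    and ke: "\<exists>t\<le>10. eval P [x] ke (enc_nat k) t"
    and Q: "\<And>L g. solver_run D z \<Gamma> vals \<rho> n cs k L \<Longrightarrow> solver_run.ok vals n k g \<Longrightarrow>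
      calls_in P 15 [enc_assignment g, q] (enc_bool (Q g)) (900 * L ^ 4)"
  shows "\<exists>t. runs P x (enc_bool (\<exists>g\<in>set (visits cs (kernel n cs k) k []). Q g)) t \<and>
    t \<le> arith_val time k * Suc (size x) ^ 6"
proof -
  define b where "b = arith_val branching k"
  define L where "L = b * Suc (size x)"
  have b: "language_size \<le> b" "Suc k * (Suc k * Suc A ^ Suc k) \<le> b"
    by (simp_all add: b_def branching_val)
  have "0 < Suc k * Suc A ^ Suc k"
    unfolding nat_0_less_mult_iff by simp
  then have "Suc k * 1 \<le> Suc k * (Suc k * Suc A ^ Suc k)"
    by (intro mult_le_mono2) linarith
  with b(2) have k: "Suc k \<le> b" by (metis mult.right_neutral order_trans)
  then have b_pos: "0 < b" by simp
  have b_L: "b \<le> L" by (simp add: L_def)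
  have "n \<le> size x" "length cs \<le> size x"
    using length_le_size_enc_list[of cs "enc_constraint \<rho>"] by (simp_all add: x enc_instance_def)
  moreover have "size x \<le> L" using b_pos by (cases b) (simp_all add: L_def)
  ultimately have L_instance: "n \<le> L" "length cs \<le> L" by linarith+
  have L_language: "language_size \<le> L" using b(1) b_L by linarith
  interpret run: solver_run D z \<Gamma> vals \<rho> ke fe n cs k L
    by unfold_locales
      (use inst k b_L b_pos L_instance order_trans[OF language_size(1) L_language]
        order_trans[OF language_size(2) L_language] order_trans[OF language_size(3) L_language]
       in simp_all)
  have "calls_in P 0 [x] (enc_bool (\<exists>g\<in>set (visits cs (kernel n cs k) k []). Q g))
      (22000 * L ^ 6 * Suc (Suc b * Suc A) ^ k)"
    by (rule run.run_main[OF ke _ Q[OF run.solver_run_axioms] b(2) b_L])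
      (use x order_trans[OF language_size(2) b(1)] in \<open>simp_all add: enc_instance_def\<close>)
  then obtain t where t: "call P 0 [x] (enc_bool (\<exists>g\<in>set (visits cs (kernel n cs k) k []). Q g)) t"
      "t \<le> 22000 * L ^ 6 * Suc (Suc b * Suc A) ^ k"
    by (auto simp: calls_in_def)
  have "runs P x (enc_bool (\<exists>g\<in>set (visits cs (kernel n cs k) k []). Q g)) (1 + t + 1)"
    using call_iff[OF t(1)] by (simp add: runs_def run_simps)
  moreover have "1 + t + 1 \<le> arith_val time k * Suc (size x) ^ 6"
  proof -
    have "L ^ 6 * Suc (Suc b * Suc A) ^ k \<ge> 1"
      using b_pos by (simp add: L_def)
    with t(2) have "1 + t + 1 \<le> 22002 * (L ^ 6 * Suc (Suc b * Suc A) ^ k)"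
      by linarith
    also have "\<dots> = arith_val time k * Suc (size x) ^ 6"
      unfolding time_val b_def[symmetric] L_def power_mult_distrib by (simp only: ac_simps)
    finally show ?thesis .
  qed
  ultimately show ?thesis by blast
qed

end

lemma weakly_separable_ocsp_fpt:
  assumes "finite D" and "z \<in> D" and "finite \<Gamma>" and "weakly_separable z \<Gamma>"
  shows "ocsp_fpt D z \<Gamma>"
  unfolding ocsp_fpt_def
proof (intro allI impI)
  fix \<rho> :: "'a relation \<Rightarrow> nat"
  assume \<rho>: "inj_on \<rho> \<Gamma>"
  \<comment> \<open>Here inputs do not mention values, so the numbering of the values is internal
    and any enumeration serves.\<close>
  obtain as where as: "distinct as" "set as = D - {z}"
    using finite_distinct_list[of "D - {z}"] assms(1) by auto
  interpret solver D z \<Gamma> as \<rho> "RightOf (Var 0)" "Call 3 [Var 0, Var 1]"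
    using assms as \<rho> by unfold_locales
  show "fpt {(I, k). input_instance \<Gamma> I} (\<lambda>(I, k). Node (enc_instance \<rho> I) (enc_nat k)) (\<lambda>(I, k). k)
      (\<lambda>((n, cs), k). ocsp_solvable D z {..<n} (set cs) k)"
    unfolding fpt_def
  proof (rule exI[of _ P], rule exI[of _ "arith_val time"], rule exI[of _ 6], intro conjI ballI)
    show "computable (arith_val time)" by (rule computable_arith)
    fix x :: "'a input_instance \<times> nat"
    assume "x \<in> {(I, k). input_instance \<Gamma> I}"
    then obtain n cs k where x: "x = ((n, cs), k)" and inst: "input_instance \<Gamma> (n, cs)" by auto
    let ?x = "Node (enc_instance \<rho> (n, cs)) (enc_nat k)"
    have "\<exists>t. runs P ?x (enc_bool (\<exists>g\<in>set (visits cs (kernel n cs k) k []). length g = k)) t \<and>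
        t \<le> arith_val time k * Suc (size ?x) ^ 6"
    proof (rule decides[OF inst refl])
      show "\<exists>t\<le>10. eval P [?x] (RightOf (Var 0)) (enc_nat k) t"
        by (simp add: run_simps)
    qed (rule solver_run.run_size_test[OF _ refl])
    then obtain t where "runs P ?x (enc_bool (ocsp_solvable D z {..<n} (set cs) k)) t"
        "t \<le> arith_val time k * Suc (size ?x) ^ 6"
      unfolding ocsp_search[OF inst] by blast
    then show "\<exists>y t. runs P ((\<lambda>(I, k). Node (enc_instance \<rho> I) (enc_nat k)) x) y t \<and>
        t \<le> arith_val time ((\<lambda>(I, k). k) x) *
          Suc (size ((\<lambda>(I, k). Node (enc_instance \<rho> I) (enc_nat k)) x)) ^ 6 \<and>
        (y \<noteq> Leaf) = (\<lambda>((n, cs), k). ocsp_solvable D z {..<n} (set cs) k) x"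
      unfolding x by (intro exI[of _ "enc_bool (ocsp_solvable D z {..<n} (set cs) k)"] exI[of _ t]) simp
  qed
qed

lemma weakly_separable_ccsp_fpt:
  assumes "z \<in> D" and "finite \<Gamma>" and "weakly_separable z \<Gamma>"
  shows "ccsp_fpt D z \<Gamma>"
  unfolding ccsp_fpt_def
proof (intro allI impI)
  fix \<rho> :: "'a relation \<Rightarrow> nat" and as
  assume \<rho>: "inj_on \<rho> \<Gamma>" and as: "distinct as" "set as = D - {z}"
  \<comment> \<open>The comparison of counts starts at code 1, because code 0 belongs to
    \<open>z\<close>.\<close>
  interpret solver D z \<Gamma> as \<rho> "RightOf (RightOf (Var 0))"
      "Call 17 [Var 0, Quote (enc_nat 1), LeftOf (Var 1)]"
    using assms as \<rho> by unfold_locales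
  let ?enc = "\<lambda>(I, \<pi>, k). Node (enc_instance \<rho> I) (Node (enc_list (enc_nat \<circ> \<pi>) as) (enc_nat k))"
  show "fpt {(I, \<pi>, k). input_instance \<Gamma> I \<and> k = (\<Sum>a\<in>D - {z}. \<pi> a)} ?enc (\<lambda>(I, \<pi>, k). k)
      (\<lambda>((n, cs), \<pi>, k). ccsp_solvable D z {..<n} (set cs) \<pi>)"
    unfolding fpt_def
  proof (rule exI[of _ P], rule exI[of _ "arith_val time"], rule exI[of _ 6], intro conjI ballI)
    show "computable (arith_val time)" by (rule computable_arith)
    fix x :: "'a input_instance \<times> ('a \<Rightarrow> nat) \<times> nat"
    assume "x \<in> {(I, \<pi>, k). input_instance \<Gamma> I \<and> k = (\<Sum>a\<in>D - {z}. \<pi> a)}"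
    then obtain n cs \<pi> k where x: "x = ((n, cs), \<pi>, k)" and inst: "input_instance \<Gamma> (n, cs)"
      and k: "k = (\<Sum>a\<in>D - {z}. \<pi> a)" by auto
    have enc: "enc_list (enc_nat \<circ> \<pi>) as = enc_list enc_nat (map \<pi> as)"
      by (simp add: enc_list_def foldr_map comp_def)
    let ?x = "Node (enc_instance \<rho> (n, cs)) (Node (enc_list enc_nat (map \<pi> as)) (enc_nat k))"
    have "\<exists>t. runs P ?x (enc_bool (\<exists>g\<in>set (visits cs (kernel n cs k) k []).
          \<forall>j<A. count_list (map snd g) (Suc j) = map \<pi> as ! j)) t \<and>
        t \<le> arith_val time k * Suc (size ?x) ^ 6"
    proof (rule decides[OF inst refl])
      show "\<exists>t\<le>10. eval P [?x] (RightOf (RightOf (Var 0))) (enc_nat k) t"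
        by (simp add: run_simps)
    qed (rule solver_run.run_profile_test[OF _ refl]; simp)
    moreover have "(\<exists>g\<in>set (visits cs (kernel n cs k) k []).
        \<forall>j<A. count_list (map snd g) (Suc j) = map \<pi> as ! j) \<longleftrightarrow> ccsp_solvable D z {..<n} (set cs) \<pi>"
      using ccsp_search[OF inst k] by simp
    ultimately obtain t where "runs P ?x (enc_bool (ccsp_solvable D z {..<n} (set cs) \<pi>)) t"
        "t \<le> arith_val time k * Suc (size ?x) ^ 6"
      by auto
    then show "\<exists>y t. runs P (?enc x) y t \<and> t \<le> arith_val time ((\<lambda>(I, \<pi>, k). k) x) * Suc (size (?enc x)) ^ 6 \<and>
        (y \<noteq> Leaf) = (\<lambda>((n, cs), \<pi>, k). ccsp_solvable D z {..<n} (set cs) \<pi>) x"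
      unfolding x by (intro exI[of _ "enc_bool (ccsp_solvable D z {..<n} (set cs) \<pi>)"] exI[of _ t])
        (simp add: enc)
  qed
qed

theorem theorem3p5:
  fixes D :: "'d set" and z :: 'd and \<Gamma> :: "'d relation set"
  assumes "finite D" and "z \<in> D"
    and "finite \<Gamma>"
    and "cc0_language D z \<Gamma>"
    and "weakly_separable z \<Gamma>"
  shows "ccsp_fpt D z \<Gamma> \<and> ocsp_fpt D z \<Gamma>"
  using weakly_separable_ccsp_fpt[OF assms(2,3,5)] weakly_separable_ocsp_fpt[OF assms(1-3,5)] ..

end
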